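(* Let $\Gamma, G$ be finitely generated groups, let $\Gamma\curvearrowright(X,\mu)$ be a probability-measure-preserving action, and let $\alpha:\Gamma\times X\to G$ be an $L^1$-embedding. Define $\alpha':\Gamma\times X\to G$ by $$\alpha'(g,x)=\alpha(g^{-1},x)^{-1}.$$ Let $\bar\Gamma,\bar G$ denote the end compactifications of $\Gamma, G$ with respect to fixed finite generating sets. Then $\alpha'$ extends to a map, also denoted $\alpha'$, from $\bar\Gamma\times X$ to $\bar G$ such that, writing $\alpha'_x(\xi):=\alpha'(\xi,x)$, (1) $\alpha'_{gx}(g\xi)=\alpha(g,x)\,\alpha'_x(\xi)$ for all $g\in\Gamma$, $\xi\in\bar\Gamma$ and a.e. $x\in X$; (2) $\alpha'_x:\bar\Gamma\to\bar G$ is continuous for a.e. $x\in X$.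
   Context: Word length: for a finitely generated group $G$ with a fixed finite symmetric generating set $S_G$, $|g|_G$ is the smallest $n\ge 0$ such that $g=s_1\cdots s_n$ with $s_i\in S_G$. Cocycle: a map $\alpha:\Gamma\times X\to G$ with $\alpha(g_1g_2,x)=\alpha(g_1,g_2x)\alpha(g_2,x)$ for all $g_1,g_2\in\Gamma$, $x\in X$. $L^1$-embedding: a measurable cocycle $\alpha:\Gamma\times X\to G$ over a probability-measure-preserving action such that (i) $\int|\alpha(g,x)|_G\,d\mu(x)<\infty$ for every $g\in\Gamma$, and (ii) there is a constant $C>0$ such that for every $h\in G$, $\#\{g\in\Gamma:\alpha(g,x)=h\}\le C$ for a.e. $x$. Ends: for a connected, locally connected, $\sigma$-compact topological space $Y$ and compact $K\subset Y$, $\pi_0(Y\setminus K)$ denotes the set of noncompact connected components of $Y\setminus K$. $\operatorname{End}(Y):=\varprojlim_K\pi_0(Y\setminus K)$, the inverse limit over compact $K\subset Y$ ordered by inclusion; i.e. an end is a family $(C_K)_K$ with $C_K\in\pi_0(Y\setminus K)$ and $C_L\subset C_K$ whenever $K\subset L$. Let $\pi_K:\operatorname{End}(Y)\to\pi_0(Y\setminus K)$ be the projection. The end compactification is $\overline Y:=Y\cup\operatorname{End}(Y)$ with the topology whose basis consists of the open subsets of $Y$ and the sets $C\cup\{\xi\in\operatorname{End}(Y):\pi_K(\xi)=C\}$ for $K\subset Y$ compact and $C\in\pi_0(Y\setminus K)$. Cayley graph: for a group $H$ with finite generating set $S$, $\mathrm{Cay}(H,S)$ has vertex set $H$ and edge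 set $\{(g,gs):g\in H,s\in S\}$ (one edge for each such ordered pair), regarded as a topological space (1-complex). $\bar H$ denotes $\overline{\mathrm{Cay}(H,S)}$. Left multiplication of $H$ on $\mathrm{Cay}(H,S)$ extends to an action of $H$ on $\bar H$ by homeomorphisms; this is the action meant by $g\xi$ and by $\alpha(g,x)\alpha'_x(\xi)$. *)

theory Defs
  imports
    "HOL-Algebra.Group_Action"
    "HOL-Algebra.Generated_Groups"
    "HOL-Probability.Probability"
begin

section \<open>Generating sets and word length\<close>

definition finite_generating_set :: "('g, 'z) monoid_scheme \<Rightarrow> 'g set \<Rightarrow> bool" where
  "finite_generating_set H S \<longleftrightarrow> finite S \<and> S \<subseteq> carrier H \<and> generate H S = carrier H"

definition symmetric_set :: "('g, 'z) monoid_scheme \<Rightarrow> 'g set \<Rightarrow> bool" where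
  "symmetric_set H S \<longleftrightarrow> (\<forall>s\<in>S. inv\<^bsub>H\<^esub> s \<in> S)"

definition word_length :: "('g, 'z) monoid_scheme \<Rightarrow> 'g set \<Rightarrow> 'g \<Rightarrow> nat" where
  "word_length H S g =
     (LEAST n. \<exists>ws. length ws = n \<and> set ws \<subseteq> S \<and> g = foldr (\<lambda>s t. s \<otimes>\<^bsub>H\<^esub> t) ws \<one>\<^bsub>H\<^esub>)"


section \<open>Measure-preserving actions and cocycles\<close>

definition pmp_action :: "('g, 'z) monoid_scheme \<Rightarrow> 'x measure \<Rightarrow> ('g \<Rightarrow> 'x \<Rightarrow> 'x) \<Rightarrow> bool" where
  "pmp_action \<Gamma> M \<phi> \<longleftrightarrow>
     prob_space M \<and> group_action \<Gamma> (space M) \<phi> \<and>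
     (\<forall>g\<in>carrier \<Gamma>. \<phi> g \<in> M \<rightarrow>\<^sub>M M \<and> distr M M (\<phi> g) = M)"

definition cocycle ::
  "('g, 'z) monoid_scheme \<Rightarrow> ('h, 'w) monoid_scheme \<Rightarrow> 'x set \<Rightarrow> ('g \<Rightarrow> 'x \<Rightarrow> 'x) \<Rightarrow>
   ('g \<Rightarrow> 'x \<Rightarrow> 'h) \<Rightarrow> bool" where
  "cocycle \<Gamma> G X \<phi> \<alpha> \<longleftrightarrow>
     (\<forall>g\<in>carrier \<Gamma>. \<forall>x\<in>X. \<alpha> g x \<in> carrier G) \<and>
     (\<forall>g1\<in>carrier \<Gamma>. \<forall>g2\<in>carrier \<Gamma>. \<forall>x\<in>X.
        \<alpha> (g1 \<otimes>\<^bsub>\<Gamma>\<^esub> g2) x = \<alpha> g1 (\<phi> g2 x) \<otimes>\<^bsub>G\<^esub> \<alpha> g2 x)"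

definition L1_embedding ::
  "('g, 'z) monoid_scheme \<Rightarrow> ('h, 'w) monoid_scheme \<Rightarrow> 'h set \<Rightarrow> 'x measure \<Rightarrow>
   ('g \<Rightarrow> 'x \<Rightarrow> 'x) \<Rightarrow> ('g \<Rightarrow> 'x \<Rightarrow> 'h) \<Rightarrow> bool" where
  "L1_embedding \<Gamma> G S M \<phi> \<alpha> \<longleftrightarrow>
     cocycle \<Gamma> G (space M) \<phi> \<alpha> \<and>
     (\<lambda>(g, x). \<alpha> g x) \<in> count_space (carrier \<Gamma>) \<Otimes>\<^sub>M M \<rightarrow>\<^sub>M count_space (carrier G) \<and>
     (\<forall>g\<in>carrier \<Gamma>. integrable M (\<lambda>x. real (word_length G S (\<alpha> g x)))) \<and>
     (\<exists>C>0::real. \<forall>h\<in>carrier G. AE x in M.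
        finite {g \<in> carrier \<Gamma>. \<alpha> g x = h} \<and> real (card {g \<in> carrier \<Gamma>. \<alpha> g x = h}) \<le> C)"

definition dual_cocycle ::
  "('g, 'z) monoid_scheme \<Rightarrow> ('h, 'w) monoid_scheme \<Rightarrow> ('g \<Rightarrow> 'x \<Rightarrow> 'h) \<Rightarrow> 'g \<Rightarrow> 'x \<Rightarrow> 'h" where
  "dual_cocycle \<Gamma> G \<alpha> g x = inv\<^bsub>G\<^esub> (\<alpha> (inv\<^bsub>\<Gamma>\<^esub> g) x)"


section \<open>Ends and the end compactification\<close>

text \<open>A noncompact component may have compact closure in \<open>Y\<close>; such a component contains no
  component outside a suitable larger compact set and therefore carries no end.\<close>

definition noncompact_components :: "'p topology \<Rightarrow> 'p set \<Rightarrow> 'p set set" where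
  "noncompact_components Y K =
     {C \<in> connected_components_of (subtopology Y (topspace Y - K)). \<not> compactin Y C}"

text \<open>Elements of the inverse limit are functions on the compact subsets of \<open>Y\<close>; they are
  made extensional (by \<open>\<Pi>\<^sub>E\<close>) so that equal families are equal as functions.\<close>

definition ends :: "'p topology \<Rightarrow> ('p set \<Rightarrow> 'p set) set" where
  "ends Y = {\<xi> \<in> (\<Pi>\<^sub>E K\<in>{K. compactin Y K}. noncompact_components Y K).
     \<forall>K L. compactin Y K \<and> compactin Y L \<and> K \<subseteq> L \<longrightarrow> \<xi> L \<subseteq> \<xi> K}"

datatype 'p compactified = Pt 'p | End "'p set \<Rightarrow> 'p set"

text \<open>If \<open>Y\<close> is locally connected and Hausdorff, the generating family below is closed under
  intersections up to unions, that is, it is a basis of the topology it generates: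
  for ends this holds because \<open>\<xi> (K \<union> L) \<subseteq> \<xi> K \<inter> \<xi> L\<close>.\<close>

definition end_compactification :: "'p topology \<Rightarrow> 'p compactified topology" where
  "end_compactification Y = topology_generated_by
     ({Pt ` U | U. openin Y U} \<union>
      {Pt ` C \<union> End ` {\<xi> \<in> ends Y. \<xi> K = C} | K C. compactin Y K \<and> C \<in> noncompact_components Y K})"

text \<open>The extension to the end compactification of a self-homeomorphism \<open>f\<close> of \<open>Y\<close>:
  the component of the image end outside \<open>K\<close> is the \<open>f\<close>-image of the component of the given
  end outside the preimage of \<open>K\<close>.\<close>

fun end_extension :: "'p topology \<Rightarrow> ('p \<Rightarrow> 'p) \<Rightarrow> 'p compactified \<Rightarrow> 'p compactified" where
  "end_extension Y f (Pt p) = Pt (f p)"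
| "end_extension Y f (End \<xi>) =
     End (\<lambda>K\<in>{K. compactin Y K}. f ` \<xi> {p \<in> topspace Y. f p \<in> K})"


section \<open>Cayley graphs as one-dimensional complexes\<close>

text \<open>An edge is an ordered pair \<open>e\<close> of vertices; \<open>Inner e t\<close>, with \<open>0 < t < 1\<close>, is the point of
  the open edge at parameter \<open>t\<close>.\<close>

datatype 'v graph_point = Vertex 'v | Inner "'v \<times> 'v" real

definition edge_point :: "'v \<times> 'v \<Rightarrow> real \<Rightarrow> 'v graph_point" where
  "edge_point e t = (if t = 0 then Vertex (fst e) else if t = 1 then Vertex (snd e) else Inner e t)"

definition graph_points :: "'v set \<Rightarrow> ('v \<times> 'v) set \<Rightarrow> 'v graph_point set" where
  "graph_points V E = Vertex ` V \<union> {Inner e t | e t. e \<in> E \<and> 0 < t \<and> t < 1}"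

text \<open>The quotient (weak) topology of the disjoint union of \<open>V\<close> (discrete) and one copy of \<open>[0,1]\<close>
  for every edge.\<close>

definition graph_topology :: "'v set \<Rightarrow> ('v \<times> 'v) set \<Rightarrow> 'v graph_point topology" where
  "graph_topology V E = topology (\<lambda>U. U \<subseteq> graph_points V E \<and>
     (\<forall>e\<in>E. openin (top_of_set {0..1}) {t \<in> {0..1}. edge_point e t \<in> U}))"

lemma openin_graph_topology:
  "openin (graph_topology V E) U \<longleftrightarrow> U \<subseteq> graph_points V E \<and>
     (\<forall>e\<in>E. openin (top_of_set {0..1}) {t \<in> {0..1}. edge_point e t \<in> U})"
proof -
  have "istopology (\<lambda>U. U \<subseteq> graph_points V E \<and>
     (\<forall>e\<in>E. openin (top_of_set {0..1}) {t \<in> {0..1}. edge_point e t \<in> U}))"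
    unfolding istopology_def
  proof (intro conjI allI impI ballI)
    fix S T e
    assume "S \<subseteq> graph_points V E \<and>
        (\<forall>e\<in>E. openin (top_of_set {0..1}) {t \<in> {0..1}. edge_point e t \<in> S})"
      and "T \<subseteq> graph_points V E \<and>
        (\<forall>e\<in>E. openin (top_of_set {0..1}) {t \<in> {0..1}. edge_point e t \<in> T})"
      and "e \<in> E"
    then have "openin (top_of_set {0..1})
        ({t \<in> {0..1}. edge_point e t \<in> S} \<inter> {t \<in> {0..1}. edge_point e t \<in> T})"
      by blast
    moreover have "{t \<in> {0..1}. edge_point e t \<in> S} \<inter> {t \<in> {0..1}. edge_point e t \<in> T}
        = {t \<in> {0..1}. edge_point e t \<in> S \<inter> T}"
      by blast
    ultimately show "openin (top_of_set {0..1}) {t \<in> {0..1}. edge_point e t \<in> S \<inter> T}"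
      by simp
  next
    fix \<K> e
    assume \<K>: "\<forall>K\<in>\<K>. K \<subseteq> graph_points V E \<and>
        (\<forall>e\<in>E. openin (top_of_set {0..1}) {t \<in> {0..1}. edge_point e t \<in> K})"
      and "e \<in> E"
    then have "openin (top_of_set {0..1}) (\<Union>K\<in>\<K>. {t \<in> {0..1}. edge_point e t \<in> K})"
      by blast
    moreover have "(\<Union>K\<in>\<K>. {t \<in> {0..1}. edge_point e t \<in> K})
        = {t \<in> {0..1}. edge_point e t \<in> \<Union>\<K>}"
      by blast
    ultimately show "openin (top_of_set {0..1}) {t \<in> {0..1}. edge_point e t \<in> \<Union>\<K>}"
      by simp
  qed blast+
  then show ?thesis
    unfolding graph_topology_def by (simp add: topology_inverse')
qed

definition cayley_edges :: "('g, 'z) monoid_scheme \<Rightarrow> 'g set \<Rightarrow> ('g \<times> 'g) set" where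
  "cayley_edges H S = {(g, g \<otimes>\<^bsub>H\<^esub> s) | g s. g \<in> carrier H \<and> s \<in> S}"

definition cayley_graph :: "('g, 'z) monoid_scheme \<Rightarrow> 'g set \<Rightarrow> 'g graph_point topology" where
  "cayley_graph H S = graph_topology (carrier H) (cayley_edges H S)"

fun cayley_translation ::
  "('g, 'z) monoid_scheme \<Rightarrow> 'g \<Rightarrow> 'g graph_point \<Rightarrow> 'g graph_point" where
  "cayley_translation H g (Vertex v) = Vertex (g \<otimes>\<^bsub>H\<^esub> v)"
| "cayley_translation H g (Inner (u, v) t) = Inner (g \<otimes>\<^bsub>H\<^esub> u, g \<otimes>\<^bsub>H\<^esub> v) t"

abbreviation group_compactification ::
  "('g, 'z) monoid_scheme \<Rightarrow> 'g set \<Rightarrow> 'g graph_point compactified topology" where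
  "group_compactification H S \<equiv> end_compactification (cayley_graph H S)"

definition compactified_action ::
  "('g, 'z) monoid_scheme \<Rightarrow> 'g set \<Rightarrow> 'g \<Rightarrow>
   'g graph_point compactified \<Rightarrow> 'g graph_point compactified" where
  "compactified_action H S g = end_extension (cayley_graph H S) (cayley_translation H g)"

end

theory Submission
  imports Defs
begin

text \<open>Write \<open>f x g = \<alpha>' g x\<close>. Extend \<open>f x\<close> over the edges of the Cayley graph of \<open>\<Gamma>\<close> by sending
  the edge from \<open>g\<close> to \<open>g s\<close> to the \<open>f x g\<close>-translate of a fixed path in the Cayley graph of \<open>G\<close>
  from \<open>1\<close> to \<open>w = (f x g)\<inverse> f x (g s)\<close> which visits \<open>O(\<bar>w\<bar> + 1)\<close> vertices; since the path depends
  on \<open>w\<close> only, this extension \<open>F x\<close> inherits the equivariance of \<open>f x\<close>. As \<open>f x g = \<alpha> g (g\<inverse> x)\<close>, substituting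
  \<open>z = (g s)\<inverse> x\<close> shows that the expected number of edges of type \<open>s\<close> whose image visits a given
  vertex \<open>h\<close> is the integral of the number of \<open>g\<close> with \<open>h \<in> \<alpha> g (s z) P (\<alpha> s z)\<close>, where \<open>P w\<close> is
  the vertex set of the path to \<open>w\<close>. This is at most \<open>C \<integral> card (P (\<alpha> s z)) dz < \<infinity>\<close>. Hence for
  almost every \<open>x\<close> only finitely many edges visit \<open>h\<close>, so \<open>F x\<close> is a proper map of graphs, and
  proper continuous maps extend continuously and functorially to the end compactifications.\<close>

section \<open>Extending proper maps to ends\<close>

text \<open>Compactness of preimages is the form in which properness enters: an end of
  \<open>Y\<close> can be evaluated at the preimage of a compact subset of \<open>Z\<close>.\<close>

definition proper_continuous_map :: "'a topology \<Rightarrow> 'b topology \<Rightarrow> ('a \<Rightarrow> 'b) \<Rightarrow> bool" where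
  "proper_continuous_map Y Z F \<longleftrightarrow>
     continuous_map Y Z F \<and> (\<forall>K. compactin Z K \<longrightarrow> compactin Y {y \<in> topspace Y. F y \<in> K})"

text \<open>The choice ranges over all components outside \<open>K\<close>. That the chosen one is
  noncompact is not built in; it is proved in \<open>end_map_in_ends\<close>.\<close>

definition end_map :: "'a topology \<Rightarrow> 'b topology \<Rightarrow> ('a \<Rightarrow> 'b) \<Rightarrow> ('a set \<Rightarrow> 'a set) \<Rightarrow> 'b set \<Rightarrow> 'b set" where
  "end_map Y Z F \<xi> = (\<lambda>K\<in>{K. compactin Z K}.
     THE D. D \<in> connected_components_of (subtopology Z (topspace Z - K)) \<and>
       F ` \<xi> {y \<in> topspace Y. F y \<in> K} \<subseteq> D)"

fun compactified_map :: "'a topology \<Rightarrow> 'b topology \<Rightarrow> ('a \<Rightarrow> 'b) \<Rightarrow> 'a compactified \<Rightarrow> 'b compactified" where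
  "compactified_map Y Z F (Pt y) = Pt (F y)"
| "compactified_map Y Z F (End \<xi>) = End (end_map Y Z F \<xi>)"

lemma the_component_containing:
  assumes "D \<in> connected_components_of X" "A \<subseteq> D" "A \<noteq> {}"
  shows "(THE D. D \<in> connected_components_of X \<and> A \<subseteq> D) = D"
proof (rule the_equality)
  fix D' assume D': "D' \<in> connected_components_of X \<and> A \<subseteq> D'"
  then have "\<not> disjnt D D'"
    using assms by (auto simp: disjnt_def)
  then show "D' = D"
    using D' assms(1) connected_components_of_disjoint by metis
qed (use assms in auto)

lemma end_component:
  assumes "\<xi> \<in> ends Y" "compactin Y K"
  shows "\<xi> K \<in> noncompact_components Y K"
  using assms by (auto simp: ends_def)

lemma end_antimono:
  assumes "\<xi> \<in> ends Y" "compactin Y K" "compactin Y L" "K \<subseteq> L"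
  shows "\<xi> L \<subseteq> \<xi> K"
  using assms by (auto simp: ends_def)

lemma noncompact_componentD:
  assumes "C \<in> noncompact_components Y K"
  shows "C \<in> connected_components_of (subtopology Y (topspace Y - K))" "\<not> compactin Y C"
    "C \<noteq> {}" "C \<subseteq> topspace Y - K" "connectedin (subtopology Y (topspace Y - K)) C"
proof -
  show 1: "C \<in> connected_components_of (subtopology Y (topspace Y - K))" and "\<not> compactin Y C"
    using assms by (auto simp: noncompact_components_def)
  then show "C \<noteq> {}" by auto
  show "C \<subseteq> topspace Y - K"
    using connected_components_of_subset[OF 1] by auto
  show "connectedin (subtopology Y (topspace Y - K)) C"
    using 1 by (rule connectedin_connected_components_of)
qed

text \<open>\<open>F\<close> maps the complement of the preimage of \<open>K\<close> continuously
  into the complement of \<open>K\<close>, so the connected set selected by \<open>\<xi>\<close>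
  lands in a single component, and the description in \<open>end_map\<close> has a unique
  solution.\<close>

lemma end_map_component:
  assumes F: "proper_continuous_map Y Z F" and \<xi>: "\<xi> \<in> ends Y" and K: "compactin Z K"
  shows "end_map Y Z F \<xi> K \<in> connected_components_of (subtopology Z (topspace Z - K))"
    and "F ` \<xi> {y \<in> topspace Y. F y \<in> K} \<subseteq> end_map Y Z F \<xi> K"
proof -
  let ?L = "{y \<in> topspace Y. F y \<in> K}"
  have L: "compactin Y ?L"
    using F K by (auto simp: proper_continuous_map_def)
  note C = noncompact_componentD[OF end_component[OF \<xi> L]]
  have cont: "continuous_map (subtopology Y (topspace Y - ?L)) (subtopology Z (topspace Z - K)) F"
  proof -
    have "continuous_map Y Z F"
      using F by (simp add: proper_continuous_map_def)
    then show ?thesis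
      by (auto simp: continuous_map_in_subtopology intro!: continuous_map_from_subtopology
          dest: continuous_map_image_subset_topspace)
  qed
  have conn: "connectedin (subtopology Z (topspace Z - K)) (F ` \<xi> ?L)"
    using connectedin_continuous_map_image[OF cont C(5)] .
  \<comment> \<open>A component around a connected set exists only in a nonempty space; the image of
    the nonempty set \<open>\<xi> ?L\<close> provides a point.\<close>
  have "topspace (subtopology Z (topspace Z - K)) \<noteq> {}"
    using C(3) connectedin_subset_topspace[OF conn] by blast
  then have nontriv: "subtopology Z (topspace Z - K) \<noteq> trivial_topology"
    by (metis topspace_discrete_topology)
  then obtain D where D: "D \<in> connected_components_of (subtopology Z (topspace Z - K))"
    "F ` \<xi> ?L \<subseteq> D"
    using exists_connected_component_of_superset[OF conn] by blast
  then have "end_map Y Z F \<xi> K = D"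
    using the_component_containing[OF D] C(3) K by (simp add: end_map_def)
  with D show "end_map Y Z F \<xi> K \<in> connected_components_of (subtopology Z (topspace Z - K))"
    and "F ` \<xi> {y \<in> topspace Y. F y \<in> K} \<subseteq> end_map Y Z F \<xi> K"
    by auto
qed

lemma end_map_eqI:
  assumes F: "proper_continuous_map Y Z F" and \<xi>: "\<xi> \<in> ends Y" and K: "compactin Z K"
    and D: "D \<in> connected_components_of (subtopology Z (topspace Z - K))"
    and sub: "A \<subseteq> D" "A \<subseteq> end_map Y Z F \<xi> K" "A \<noteq> {}"
  shows "end_map Y Z F \<xi> K = D"
proof -
  have "\<not> disjnt (end_map Y Z F \<xi> K) D"
    using sub by (auto simp: disjnt_def)
  then show ?thesis
    using connected_components_of_disjoint[OF end_map_component(1)[OF F \<xi> K] D] by auto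
qed

text \<open>If the component \<open>D\<close> chosen at \<open>K\<close> were compact, so would be
  \<open>K \<union> D\<close>; what \<open>\<xi>\<close> selects outside the preimage of
  \<open>K \<union> D\<close> would then be mapped into \<open>D\<close> while avoiding the preimage
  of \<open>D\<close>. For \<open>K \<subseteq> L\<close> the components chosen at \<open>K\<close>
  and at \<open>L\<close> share the image of what \<open>\<xi>\<close> selects outside the preimage
  of \<open>L\<close>, so maximality gives the inclusion.\<close>

lemma end_map_in_ends:
  assumes F: "proper_continuous_map Y Z F" and \<xi>: "\<xi> \<in> ends Y"
  shows "end_map Y Z F \<xi> \<in> ends Z"
proof -
  have pre: "compactin Y {y \<in> topspace Y. F y \<in> K}" if "compactin Z K" for K
    using F that by (auto simp: proper_continuous_map_def)
  note E = end_map_component[OF F \<xi>]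
  have "\<not> compactin Z (end_map Y Z F \<xi> K)" if K: "compactin Z K" for K
  proof
    let ?D = "end_map Y Z F \<xi> K"
    assume "compactin Z ?D"
    with K have KD: "compactin Z (K \<union> ?D)"
      by (rule compactin_Un)
    let ?L = "{y \<in> topspace Y. F y \<in> K \<union> ?D}"
    note C = noncompact_componentD[OF end_component[OF \<xi> pre[OF KD]]]
    have "\<xi> ?L \<subseteq> \<xi> {y \<in> topspace Y. F y \<in> K}"
      using end_antimono[OF \<xi> pre[OF K] pre[OF KD]] by auto
    then have "F ` \<xi> ?L \<subseteq> ?D"
      using E(2)[OF K] by blast
    then have "\<xi> ?L \<subseteq> ?L"
      using C(4) by auto
    then show False
      using C(3,4) by auto
  qed
  moreover have "end_map Y Z F \<xi> L \<subseteq> end_map Y Z F \<xi> K"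
    if K: "compactin Z K" and L: "compactin Z L" and "K \<subseteq> L" for K L
  proof -
    let ?X = "subtopology Z (topspace Z - K)"
    have "connectedin (subtopology Z (topspace Z - L)) (end_map Y Z F \<xi> L)"
      using E(1)[OF L] by (rule connectedin_connected_components_of)
    then have conn: "connectedin ?X (end_map Y Z F \<xi> L)"
      using \<open>K \<subseteq> L\<close> by (auto simp: connectedin_subtopology)
    have "\<xi> {y \<in> topspace Y. F y \<in> L} \<subseteq> \<xi> {y \<in> topspace Y. F y \<in> K}"
      using end_antimono[OF \<xi> pre[OF K] pre[OF L]] \<open>K \<subseteq> L\<close> by auto
    then have "F ` \<xi> {y \<in> topspace Y. F y \<in> L} \<subseteq> end_map Y Z F \<xi> K"
      using E(2)[OF K] by blast
    moreover have "\<xi> {y \<in> topspace Y. F y \<in> L} \<noteq> {}"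
      using noncompact_componentD(3)[OF end_component[OF \<xi> pre[OF L]]] .
    ultimately have "\<not> disjnt (end_map Y Z F \<xi> K) (end_map Y Z F \<xi> L)"
      using E(2)[OF L] by (auto simp: disjnt_def)
    then show ?thesis
      using connected_components_of_maximal[OF E(1)[OF K] conn] by auto
  qed
  ultimately show ?thesis
    using E(1) by (auto simp: ends_def noncompact_components_def end_map_def)
qed

section \<open>Continuity and functoriality of the extended map\<close>

lemma topspace_end_compactification:
  "topspace (end_compactification Y) = Pt ` topspace Y \<union> End ` ends Y"
proof -
  have "topspace (end_compactification Y) =
    \<Union>({Pt ` U | U. openin Y U} \<union>
      {Pt ` C \<union> End ` {\<xi> \<in> ends Y. \<xi> K = C} | K C. compactin Y K \<and> C \<in> noncompact_components Y K})"
    by (simp add: end_compactification_def)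
  also have "\<dots> = Pt ` topspace Y \<union> End ` ends Y"
  proof (intro equalityI subsetI)
    fix p assume "p \<in> Pt ` topspace Y \<union> End ` ends Y"
    then consider y where "y \<in> topspace Y" "p = Pt y" | \<xi> where "\<xi> \<in> ends Y" "p = End \<xi>"
      by auto
    then show "p \<in> \<Union>({Pt ` U | U. openin Y U} \<union>
      {Pt ` C \<union> End ` {\<xi> \<in> ends Y. \<xi> K = C} | K C. compactin Y K \<and> C \<in> noncompact_components Y K})"
    proof cases
      case 1
      then show ?thesis using openin_topspace[of Y] by blast
    next
      case 2
      \<comment> \<open>The component of an end outside the empty set already places the end in a
        generating set.\<close>
      have "compactin Y {}" by simp
      with 2 end_component[OF 2(1) this] show ?thesis by blast
    qed
  next
    fix p assume "p \<in> \<Union>({Pt ` U | U. openin Y U} \<union>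
      {Pt ` C \<union> End ` {\<xi> \<in> ends Y. \<xi> K = C} | K C. compactin Y K \<and> C \<in> noncompact_components Y K})"
    then show "p \<in> Pt ` topspace Y \<union> End ` ends Y"
      using openin_subset noncompact_componentD(4) by fast
  qed
  finally show ?thesis .
qed

lemma openin_end_compactification_Pt:
  "openin Y U \<Longrightarrow> openin (end_compactification Y) (Pt ` U)"
  unfolding end_compactification_def by (rule topology_generated_by_Basis) blast

lemma openin_end_compactification_component:
  assumes "compactin Y K" "C \<in> noncompact_components Y K"
  shows "openin (end_compactification Y) (Pt ` C \<union> End ` {\<xi> \<in> ends Y. \<xi> K = C})"
  unfolding end_compactification_def by (rule topology_generated_by_Basis) (use assms in blast)

text \<open>It suffices to pull back generating sets. By \<open>closed\<close> and
  \<open>loc\<close>, components outside compact subsets of \<open>Z\<close> are open, which makes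
  their preimages in \<open>Y\<close> open.\<close>

lemma continuous_compactified_map:
  assumes F: "proper_continuous_map Y Z F"
    and closed: "\<And>K. compactin Z K \<Longrightarrow> closedin Z K"
    and loc: "\<And>U C. openin Z U \<Longrightarrow> C \<in> connected_components_of (subtopology Z U) \<Longrightarrow> openin Z C"
  shows "continuous_map (end_compactification Y) (end_compactification Z) (compactified_map Y Z F)"
proof -
  have cont: "continuous_map Y Z F"
    using F by (simp add: proper_continuous_map_def)
  have pre: "compactin Y {y \<in> topspace Y. F y \<in> K}" if "compactin Z K" for K
    using F that by (auto simp: proper_continuous_map_def)
  note E = end_map_component[OF F]
  let ?f = "compactified_map Y Z F" and ?Y = "end_compactification Y"
  let ?\<S> = "{Pt ` U | U. openin Z U} \<union>
      {Pt ` C \<union> End ` {\<xi> \<in> ends Z. \<xi> K = C} | K C. compactin Z K \<and> C \<in> noncompact_components Z K}"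
  show ?thesis
    unfolding end_compactification_def[of Z]
  proof (rule continuous_on_generated_topo)
    show "?f ` topspace ?Y \<subseteq> \<Union>?\<S>"
    proof -
      have "\<Union>?\<S> = topspace (end_compactification Z)"
        by (simp add: end_compactification_def)
      then show ?thesis
        using continuous_map_image_subset_topspace[OF cont] end_map_in_ends[OF F]
        by (auto simp: topspace_end_compactification)
    qed
    fix S assume "S \<in> ?\<S>"
    then consider U where "openin Z U" "S = Pt ` U"
      | K D where "compactin Z K" "D \<in> noncompact_components Z K"
          "S = Pt ` D \<union> End ` {\<xi> \<in> ends Z. \<xi> K = D}"
      by blast
    then show "openin ?Y (?f -` S \<inter> topspace ?Y)"
    proof cases
      case 1
      have "?f -` S \<inter> topspace ?Y = Pt ` {y \<in> topspace Y. F y \<in> U}"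
        using 1(2) by (auto simp: topspace_end_compactification)
      moreover have "openin Y {y \<in> topspace Y. F y \<in> U}"
        using cont 1(1) by (rule openin_continuous_map_preimage)
      ultimately show ?thesis
        using openin_end_compactification_Pt by metis
    next
      case 2
      let ?L = "{y \<in> topspace Y. F y \<in> K}"
      \<comment> \<open>An end maps into the neighbourhood given by \<open>D\<close> exactly when
        its component outside \<open>?L\<close> is mapped into \<open>D\<close>. The preimage is
        therefore the \<open>F\<close>-preimage of \<open>D\<close> together with the basic
        neighbourhoods of the components in \<open>?C\<close>.\<close>
      let ?C = "{C \<in> noncompact_components Y ?L. F ` C \<subseteq> D}"
      let ?B = "\<lambda>C. Pt ` C \<union> End ` {\<xi> \<in> ends Y. \<xi> ?L = C}"
      note D = noncompact_componentD[OF 2(2)]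
      have "openin Z (topspace Z - K)"
        using closed[OF 2(1)] by auto
      then have "openin Z D"
        using D(1) loc by blast
      then have opD: "openin ?Y (Pt ` {y \<in> topspace Y. F y \<in> D})"
        using openin_continuous_map_preimage[OF cont] openin_end_compactification_Pt by metis
      have "openin ?Y (?B C)" if "C \<in> ?C" for C
        using openin_end_compactification_component[OF pre[OF 2(1)]] that by auto
      then have op: "openin ?Y (Pt ` {y \<in> topspace Y. F y \<in> D} \<union> \<Union>(?B ` ?C))"
        using opD by blast
      have "?f -` S \<inter> topspace ?Y = Pt ` {y \<in> topspace Y. F y \<in> D} \<union> \<Union>(?B ` ?C)"
      proof (intro equalityI subsetI)
        fix p assume p: "p \<in> ?f -` S \<inter> topspace ?Y"
        then consider y where "y \<in> topspace Y" "p = Pt y" | \<xi> where "\<xi> \<in> ends Y" "p = End \<xi>"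
          by (auto simp: topspace_end_compactification)
        then show "p \<in> Pt ` {y \<in> topspace Y. F y \<in> D} \<union> \<Union>(?B ` ?C)"
        proof cases
          case 1
          then show ?thesis using p 2(3) by auto
        next
          case b: 2
          have "end_map Y Z F \<xi> K = D"
            using p 2(3) b by auto
          then have "\<xi> ?L \<in> ?C"
            using E(2)[OF b(1) 2(1)] end_component[OF b(1) pre[OF 2(1)]] by auto
          then show ?thesis
            using b by blast
        qed
      next
        fix p assume "p \<in> Pt ` {y \<in> topspace Y. F y \<in> D} \<union> \<Union>(?B ` ?C)"
        then consider y where "y \<in> topspace Y" "F y \<in> D" "p = Pt y"
          | y C where "C \<in> ?C" "y \<in> C" "p = Pt y"
          | \<xi> where "\<xi> \<in> ends Y" "\<xi> ?L \<in> ?C" "p = End \<xi>"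
          by blast
        then show "p \<in> ?f -` S \<inter> topspace ?Y"
        proof cases
          case 1
          then show ?thesis using 2(3) by (auto simp: topspace_end_compactification)
        next
          case b: 2
          then show ?thesis
            using 2(3) noncompact_componentD(4)[of C] by (auto simp: topspace_end_compactification)
        next
          case b: 3
          have "end_map Y Z F \<xi> K = D"
            using b(2) noncompact_componentD(3)[of "\<xi> ?L"] E(2)[OF b(1) 2(1)]
            by (intro end_map_eqI[OF F b(1) 2(1) D(1), of "F ` \<xi> ?L"]) auto
          then show ?thesis
            using b 2(3) end_map_in_ends[OF F b(1)] by (auto simp: topspace_end_compactification)
        qed
      qed
      with op show ?thesis by simp
    qed
  qed
qed

text \<open>At each \<open>K\<close> both sides pick the component that contains the image of the
  same subset of \<open>Y\<close>, once under \<open>F' \<circ> \<sigma>\<close> and once under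
  \<open>\<tau> \<circ> F\<close>; such a component is unique.\<close>

lemma end_map_equivariant:
  assumes F: "proper_continuous_map Y Z F" and F': "proper_continuous_map Y Z F'"
    and \<sigma>: "homeomorphic_map Y Y \<sigma>" and \<tau>: "homeomorphic_map Z Z \<tau>"
    and eq: "\<And>y. y \<in> topspace Y \<Longrightarrow> F' (\<sigma> y) = \<tau> (F y)" and \<xi>: "\<xi> \<in> ends Y"
  shows "compactified_map Y Z F' (end_extension Y \<sigma> (End \<xi>)) =
    end_extension Z \<tau> (compactified_map Y Z F (End \<xi>))"
proof -
  have Y: "\<sigma> y \<in> topspace Y" if "y \<in> topspace Y" for y
    using that homeomorphic_imp_surjective_map[OF \<sigma>] by auto
  have "(THE D. D \<in> connected_components_of (subtopology Z (topspace Z - K)) \<and>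
       F' ` (\<lambda>L\<in>{L. compactin Y L}. \<sigma> ` \<xi> {y \<in> topspace Y. \<sigma> y \<in> L}) {y \<in> topspace Y. F' y \<in> K} \<subseteq> D)
     = \<tau> ` end_map Y Z F \<xi> {z \<in> topspace Z. \<tau> z \<in> K}" if K: "compactin Z K" for K
  proof (rule the_component_containing)
    let ?K = "{z \<in> topspace Z. \<tau> z \<in> K}"
    have Kim: "\<tau> ` ?K = K"
      using homeomorphic_imp_surjective_map[OF \<tau>] compactin_subset_topspace[OF K] by auto
    have K': "compactin Z ?K"
      using homeomorphic_map_compactness_eq[OF \<tau>, of ?K] Kim K by auto
    let ?A = "\<xi> {y \<in> topspace Y. F y \<in> ?K}"
    have Fz: "F y \<in> topspace Z" if "y \<in> topspace Y" for y
      using F that by (auto simp: proper_continuous_map_def continuous_map_def)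
    have "compactin Y {y \<in> topspace Y. F' y \<in> K}"
      using F' K by (auto simp: proper_continuous_map_def)
    \<comment> \<open>Hence the translated end, evaluated at the \<open>F'\<close>-preimage of
      \<open>K\<close>, is the \<open>\<sigma>\<close>-image of what \<open>\<xi>\<close> selects
      outside the \<open>F\<close>-preimage of \<open>?K\<close>.\<close>
    moreover have "{y \<in> topspace Y. \<sigma> y \<in> {y \<in> topspace Y. F' y \<in> K}} = {y \<in> topspace Y. F y \<in> ?K}"
      using eq Y Fz by auto
    ultimately have A: "(\<lambda>L\<in>{L. compactin Y L}. \<sigma> ` \<xi> {y \<in> topspace Y. \<sigma> y \<in> L})
        {y \<in> topspace Y. F' y \<in> K} = \<sigma> ` ?A"
      by simp
    have "compactin Y {y \<in> topspace Y. F y \<in> ?K}"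
      using F K' by (auto simp: proper_continuous_map_def)
    note C = noncompact_componentD[OF end_component[OF \<xi> this]]
    have A': "F' ` \<sigma> ` ?A = \<tau> ` F ` ?A"
      using eq C(4) by (auto simp: image_image intro!: image_cong)
    show "F' ` (\<lambda>L\<in>{L. compactin Y L}. \<sigma> ` \<xi> {y \<in> topspace Y. \<sigma> y \<in> L}) {y \<in> topspace Y. F' y \<in> K}
      \<subseteq> \<tau> ` end_map Y Z F \<xi> ?K"
      unfolding A A' using end_map_component(2)[OF F \<xi> K'] by blast
    show "F' ` (\<lambda>L\<in>{L. compactin Y L}. \<sigma> ` \<xi> {y \<in> topspace Y. \<sigma> y \<in> L}) {y \<in> topspace Y. F' y \<in> K} \<noteq> {}"
      unfolding A using C(3) by auto
    \<comment> \<open>\<open>\<tau>\<close> restricts to a homeomorphism between the complements of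
      \<open>?K\<close> and \<open>K\<close>, so it carries components to components.\<close>
    have "\<tau> ` (topspace Z - ?K) = topspace Z - K"
      using homeomorphic_imp_surjective_map[OF \<tau>] by auto
    then have "homeomorphic_map (subtopology Z (topspace Z - ?K)) (subtopology Z (topspace Z - K)) \<tau>"
      using homeomorphic_map_subtopologies[OF \<tau>, of "topspace Z - ?K" "topspace Z - K"]
      by (auto simp: Int_absorb1)
    then show "\<tau> ` end_map Y Z F \<xi> ?K \<in> connected_components_of (subtopology Z (topspace Z - K))"
      using end_map_component(1)[OF F \<xi> K'] homeomorphic_map_connected_components_of by blast
  qed
  then show ?thesis
    by (auto simp: end_map_def fun_eq_iff restrict_def)
qed

section \<open>The topology of a graph\<close>

text \<open>The vertices of the closed cell carrying the point. Finiteness of such vertex sets is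
  the combinatorial substitute for compactness below.\<close>

fun vertex_support :: "'v graph_point \<Rightarrow> 'v set" where
  "vertex_support (Vertex v) = {v}"
| "vertex_support (Inner e t) = {fst e, snd e}"

lemma vertex_support_nonempty: "vertex_support p \<noteq> {}"
  by (cases p) auto

lemma vertex_support_edge_point: "vertex_support (edge_point e t) \<subseteq> {fst e, snd e}"
  by (auto simp: edge_point_def)

lemma edge_point_simps [simp]:
  "edge_point e 0 = Vertex (fst e)" "edge_point e 1 = Vertex (snd e)"
  "0 < t \<Longrightarrow> t < 1 \<Longrightarrow> edge_point e t = Inner e t"
  by (auto simp: edge_point_def)

locale vertex_edge_graph =
  fixes V :: "'v set" and E :: "('v \<times> 'v) set"
  assumes edges: "E \<subseteq> V \<times> V"
begin

abbreviation "\<T> \<equiv> graph_topology V E"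

lemma edge_point_in:
  assumes "e \<in> E" "t \<in> {0..1}"
  shows "edge_point e t \<in> graph_points V E"
proof (cases "t = 0 \<or> t = 1")
  case True
  then show ?thesis using assms edges by (auto simp: graph_points_def)
next
  case False
  then show ?thesis using assms by (cases e) (auto simp: graph_points_def edge_point_def)
qed

lemma graph_point_cases:
  assumes "p \<in> graph_points V E"
  obtains v where "v \<in> V" "p = Vertex v" | e t where "e \<in> E" "t \<in> {0..1}" "p = edge_point e t"
proof (cases p)
  case (Vertex v)
  then show ?thesis using assms that(1) by (auto simp: graph_points_def)
next
  case (Inner e t)
  then show ?thesis using assms that(2)[of e t] by (auto simp: graph_points_def)
qed

lemma topspace_graph [simp]: "topspace \<T> = graph_points V E"
proof
  have "{t \<in> {0..1}. edge_point e t \<in> graph_points V E} = {0..1}" if "e \<in> E" for e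
    using edge_point_in[OF that] by auto
  then have "openin \<T> (graph_points V E)"
    by (simp add: openin_graph_topology)
  then show "graph_points V E \<subseteq> topspace \<T>"
    by (rule openin_subset)
  show "topspace \<T> \<subseteq> graph_points V E"
    using openin_topspace[of \<T>] unfolding openin_graph_topology by blast
qed

lemma continuous_map_edge_point:
  assumes "e \<in> E"
  shows "continuous_map (top_of_set {0..1}) \<T> (edge_point e)"
  unfolding continuous_map using assms edge_point_in[OF assms]
  by (auto simp: openin_graph_topology)

text \<open>Universal property of the weak topology: openness is tested on each closed edge
  separately.\<close>

lemma continuous_map_from_graph:
  assumes F: "\<And>p. p \<in> graph_points V E \<Longrightarrow> F p \<in> topspace Z"
    and "\<And>e. e \<in> E \<Longrightarrow> continuous_map (top_of_set {0..1}) Z (\<lambda>t. F (edge_point e t))"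
  shows "continuous_map \<T> Z F"
  unfolding continuous_map
proof (intro conjI allI impI)
  fix U assume U: "openin Z U"
  have "openin (top_of_set {0..1}) {t \<in> {0..1}. edge_point e t \<in> {p \<in> graph_points V E. F p \<in> U}}"
    if "e \<in> E" for e
  proof -
    have "openin (top_of_set {0..1}) {t \<in> topspace (top_of_set {0..1}). F (edge_point e t) \<in> U}"
      using assms(2)[OF that] U by (rule openin_continuous_map_preimage)
    moreover have "{t \<in> topspace (top_of_set {0..1}). F (edge_point e t) \<in> U} =
      {t \<in> {0..1}. edge_point e t \<in> {p \<in> graph_points V E. F p \<in> U}}"
      using edge_point_in[OF that] by auto
    ultimately show ?thesis by simp
  qed
  then show "openin \<T> {p \<in> topspace \<T>. F p \<in> U}"
    by (simp add: openin_graph_topology)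
qed (use F in auto)

section \<open>Separation, local connectedness and compactness in graphs\<close>

lemma closedin_graph:
  assumes "A \<subseteq> graph_points V E"
    and "\<And>e. e \<in> E \<Longrightarrow> closed {t \<in> {0..1}. edge_point e t \<in> A}"
  shows "closedin \<T> A"
proof -
  have "openin (top_of_set {0..1}) {t \<in> {0..1}. edge_point e t \<in> graph_points V E - A}"
    if "e \<in> E" for e
  proof -
    have "{t \<in> {0..1}. edge_point e t \<in> graph_points V E - A}
      = {0..1} \<inter> - {t \<in> {0..1}. edge_point e t \<in> A}"
      using edge_point_in[OF that] by auto
    moreover have "openin (top_of_set {0..1}) ({0..1} \<inter> - {t \<in> {0..1}. edge_point e t \<in> A})"
      using assms(2)[OF that] by (intro openin_open_Int open_Compl)
    ultimately show ?thesis by simp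
  qed
  then show ?thesis
    using assms(1) by (simp add: closedin_def openin_graph_topology)
qed

text \<open>Continuous real functions separate the points, and disjoint neighbourhoods are pulled
  back from the real line.\<close>

lemma Hausdorff_space_graph: "Hausdorff_space \<T>"
proof -
  have sep: "\<exists>g :: 'v graph_point \<Rightarrow> real. continuous_map \<T> euclideanreal g \<and> g p \<noteq> g q"
    if "p \<in> graph_points V E" "q \<in> graph_points V E" "p \<noteq> q" for p q
  proof -
    \<comment> \<open>The indicator of \<open>v\<close>, interpolated linearly along every edge;
      adding the contributions of both ends gives the right values on loops too. These functions
      separate vertices.\<close>
    define at_vertex :: "'v \<Rightarrow> 'v graph_point \<Rightarrow> real" where
      "at_vertex v p = (case p of Vertex w \<Rightarrow> of_bool (w = v)
        | Inner e t \<Rightarrow> (1 - t) * of_bool (fst e = v) + t * of_bool (snd e = v))" for v p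
    define bump :: "'v \<times> 'v \<Rightarrow> 'v graph_point \<Rightarrow> real" where
      "bump e p = (case p of Vertex w \<Rightarrow> 0
        | Inner e' t \<Rightarrow> of_bool (e' = e) * (t * (1 - t)))" for e p
    \<comment> \<open>\<open>bump e\<close> takes equal values at the parameters \<open>t\<close>
      and \<open>1 - t\<close> of the edge \<open>e\<close>; the extra factor \<open>t\<close> tells
      them apart.\<close>
    define bump' :: "'v \<times> 'v \<Rightarrow> 'v graph_point \<Rightarrow> real" where
      "bump' e p = (case p of Vertex w \<Rightarrow> 0
        | Inner e' t \<Rightarrow> of_bool (e' = e) * (t * (t * (1 - t))))" for e p
    have 1: "continuous_map \<T> euclideanreal (at_vertex v)" for v
    proof (rule continuous_map_from_graph)
      fix e assume "e \<in> E"
      have "at_vertex v (edge_point e t) = (1 - t) * of_bool (fst e = v) + t * of_bool (snd e = v)" for t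
        by (auto simp: at_vertex_def edge_point_def)
      then show "continuous_map (top_of_set {0..1}) euclideanreal (\<lambda>t. at_vertex v (edge_point e t))"
        by (auto intro!: continuous_intros)
    qed auto
    have 2: "continuous_map \<T> euclideanreal (bump e)" for e
    proof (rule continuous_map_from_graph)
      fix e' assume "e' \<in> E"
      have "bump e (edge_point e' t) = of_bool (e' = e) * (t * (1 - t))" for t
        by (auto simp: bump_def edge_point_def)
      then show "continuous_map (top_of_set {0..1}) euclideanreal (\<lambda>t. bump e (edge_point e' t))"
        by (auto intro!: continuous_intros)
    qed auto
    have 3: "continuous_map \<T> euclideanreal (bump' e)" for e
    proof (rule continuous_map_from_graph)
      fix e' assume "e' \<in> E"
      have "bump' e (edge_point e' t) = of_bool (e' = e) * (t * (t * (1 - t)))" for t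
        by (auto simp: bump'_def edge_point_def)
      then show "continuous_map (top_of_set {0..1}) euclideanreal (\<lambda>t. bump' e (edge_point e' t))"
        by (auto intro!: continuous_intros)
    qed auto
    have inner: "\<exists>g :: 'v graph_point \<Rightarrow> real. continuous_map \<T> euclideanreal g \<and> g (Inner e t) \<noteq> g r"
      if "0 < t" "t < 1" "r \<noteq> Inner e t" for e t r
    proof (cases "bump e (Inner e t) = bump e r")
      case True
      have "t * (1 - t) \<noteq> 0" using that by auto
      moreover have "bump e (Inner e t) = t * (1 - t)"
        by (simp add: bump_def)
      ultimately have "bump e r \<noteq> 0" "bump e r = t * (1 - t)"
        using True by auto
      then obtain t' where r: "r = Inner e t'" and eq: "t' * (1 - t') = t * (1 - t)"
        by (cases r) (auto simp: bump_def of_bool_def split: if_splits)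
      have "bump' e (Inner e t) = t * (t * (1 - t))" "bump' e r = t' * (t * (1 - t))"
        using r eq by (auto simp: bump'_def)
      moreover have "t \<noteq> t'" using r that by auto
      ultimately have "bump' e (Inner e t) \<noteq> bump' e r"
        using that by auto
      with 3 show ?thesis by blast
    qed (use 2 in blast)
    consider e t where "p = Inner e t" "0 < t" "t < 1" | e t where "q = Inner e t" "0 < t" "t < 1"
      | v w where "p = Vertex v" "q = Vertex w"
      using \<open>p \<in> _\<close> \<open>q \<in> _\<close> by (auto simp: graph_points_def)
    then show ?thesis
    proof cases
      case 1
      with inner[of t q e] \<open>p \<noteq> q\<close> show ?thesis by auto
    next
      case 2
      with inner[of t p e] \<open>p \<noteq> q\<close> show ?thesis by (metis (no_types))
    next
      case c: 3
      then have "at_vertex v p \<noteq> at_vertex v q"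
        using \<open>p \<noteq> q\<close> by (auto simp: at_vertex_def)
      with 1 show ?thesis by blast
    qed
  qed
  show ?thesis
    unfolding Hausdorff_space_def
  proof (intro allI impI)
    fix p q assume pq: "p \<in> topspace \<T> \<and> q \<in> topspace \<T> \<and> p \<noteq> q"
    then obtain g :: "'v graph_point \<Rightarrow> real" where g: "continuous_map \<T> euclideanreal g" "g p \<noteq> g q"
      using sep by (metis topspace_graph)
    obtain A B where AB: "open A" "open B" "g p \<in> A" "g q \<in> B" "A \<inter> B = {}"
      using g(2) hausdorff by metis
    have "openin \<T> {x \<in> topspace \<T>. g x \<in> A}" "openin \<T> {x \<in> topspace \<T>. g x \<in> B}"
      using AB g(1) by (auto intro!: openin_continuous_map_preimage simp del: topspace_graph)
    moreover have "disjnt {x \<in> topspace \<T>. g x \<in> A} {x \<in> topspace \<T>. g x \<in> B}"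
      using AB by (auto simp: disjnt_def)
    ultimately show "\<exists>U W. openin \<T> U \<and> openin \<T> W \<and> p \<in> U \<and> q \<in> W \<and> disjnt U W"
      using AB(3,4) pq by blast
  qed
qed

text \<open>Local connectedness: a short interval of an edge around a point of \<open>C\<close>
  stays inside \<open>U\<close> and is connected, so it stays inside \<open>C\<close>.\<close>

lemma openin_graph_component:
  assumes U: "openin \<T> U" and C: "C \<in> connected_components_of (subtopology \<T> U)"
  shows "openin \<T> C"
  unfolding openin_graph_topology
proof (intro conjI ballI)
  have CU: "C \<subseteq> U" "C \<subseteq> graph_points V E"
    using connected_components_of_subset[OF C] by auto
  then show "C \<subseteq> graph_points V E" by simp
  fix e assume e: "e \<in> E"
  let ?I = "\<lambda>A. {t \<in> {0..1}. edge_point e t \<in> A}"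
  have "openin (top_of_set {0..1}) (?I U)"
    using U e by (simp add: openin_graph_topology)
  then obtain W where W: "open W" "?I U = {0..1} \<inter> W"
    by (auto simp: openin_open)
  show "openin (top_of_set {0..1}) (?I C)"
  proof (subst openin_subopen, intro ballI)
    fix t assume t: "t \<in> ?I C"
    then have "t \<in> W" using CU W(2) by blast
    then obtain d where d: "d > 0" "ball t d \<subseteq> W"
      using W(1) open_contains_ball by blast
    let ?J = "{0..1} \<inter> ball t d"
    have sub: "edge_point e ` ?J \<subseteq> U"
      using d W(2) by blast
    have "connected ?J"
      by (intro convex_connected convex_Int) auto
    then have "connectedin (top_of_set {0..1}) ?J"
      by (simp add: connectedin_subtopology)
    then have "connectedin \<T> (edge_point e ` ?J)"
      using connectedin_continuous_map_image[OF continuous_map_edge_point[OF e]] by blast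
    then have "connectedin (subtopology \<T> U) (edge_point e ` ?J)"
      using sub by (simp add: connectedin_subtopology)
    moreover have "t \<in> ?J" using t d by auto
    then have "\<not> disjnt C (edge_point e ` ?J)"
      using t by (auto simp: disjnt_def)
    ultimately have "edge_point e ` ?J \<subseteq> C"
      using connected_components_of_maximal[OF C] by blast
    then have "?J \<subseteq> ?I C" by auto
    moreover have "openin (top_of_set {0..1}) ?J"
      by (simp add: openin_open_Int)
    ultimately show "\<exists>T. openin (top_of_set {0..1}) T \<and> t \<in> T \<and> T \<subseteq> ?I C"
      using \<open>t \<in> ?J\<close> by blast
  qed
qed

text \<open>The vertices in \<open>K\<close>, together with one chosen point of \<open>K\<close> in
  each open edge that \<open>K\<close> meets, form a set \<open>T\<close> without accumulation
  points. By Bolzano-Weierstrass \<open>T\<close> is finite, so \<open>K\<close> meets finitely many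
  open cells.\<close>

lemma finite_vertex_support_compact:
  assumes K: "compactin \<T> K"
  shows "finite (\<Union>(vertex_support ` K))"
proof -
  have KV: "K \<subseteq> graph_points V E"
    using compactin_subset_topspace[OF K] by simp
  define A where "A = {v. Vertex v \<in> K}"
  define B where "B = {e. \<exists>t. Inner e t \<in> K}"
  define c where "c e = (SOME t. Inner e t \<in> K)" for e
  have c: "Inner e (c e) \<in> K" if "e \<in> B" for e
    using that unfolding B_def c_def by (auto intro: someI_ex)
  define T where "T = Vertex ` A \<union> (\<lambda>e. Inner e (c e)) ` B"
  have TK: "T \<subseteq> K"
    using c by (auto simp: T_def A_def)
  have closed: "closedin \<T> T'" if T': "T' \<subseteq> T" for T'
  proof (rule closedin_graph)
    show "T' \<subseteq> graph_points V E" using T' TK KV by blast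
    fix e assume "e \<in> E"
    \<comment> \<open>On one edge a subset of \<open>T\<close> contains at most the two ends and the
      chosen point.\<close>
    have "{t \<in> {0..1}. edge_point e t \<in> T'} \<subseteq> {0, 1, c e}"
      using T' unfolding T_def by (auto simp: edge_point_def split: if_splits)
    then have "finite {t \<in> {0..1}. edge_point e t \<in> T'}"
      by (rule finite_subset) simp
    then show "closed {t \<in> {0..1}. edge_point e t \<in> T'}"
      by (rule finite_imp_closed)
  qed
  \<comment> \<open>\<open>T - {p}\<close> is closed like every subset of \<open>T\<close>, and its
    complement is a neighbourhood of \<open>p\<close> free of other points of
    \<open>T\<close>.\<close>
  have "\<T> derived_set_of T = {}"
  proof -
    have "p \<notin> \<T> derived_set_of T" for p
    proof
      assume p: "p \<in> \<T> derived_set_of T"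
      have "openin \<T> (topspace \<T> - (T - {p}))"
        using closed[of "T - {p}"] by (intro openin_diff) (auto simp del: topspace_graph)
      moreover have "p \<in> topspace \<T> - (T - {p})"
        using p by (auto simp: in_derived_set_of)
      ultimately obtain q where "q \<noteq> p" "q \<in> T" "q \<in> topspace \<T> - (T - {p})"
        using p unfolding in_derived_set_of by meson
      then show False by blast
    qed
    then show ?thesis by blast
  qed
  then have "finite T"
    using compactin_imp_Bolzano_Weierstrass[OF K] TK by blast
  then have "finite (Vertex ` A)" "finite ((\<lambda>e. Inner e (c e)) ` B)"
    by (auto simp: T_def)
  then have "finite A" "finite B"
    by (auto dest!: finite_imageD simp: inj_on_def)
  moreover have "\<Union>(vertex_support ` K) \<subseteq> A \<union> fst ` B \<union> snd ` B"
  proof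
    fix v assume "v \<in> \<Union>(vertex_support ` K)"
    then obtain p where p: "p \<in> K" "v \<in> vertex_support p" by blast
    then show "v \<in> A \<union> fst ` B \<union> snd ` B"
      by (cases p) (auto simp: A_def B_def)
  qed
  ultimately show ?thesis
    by (meson finite_UnI finite_imageI finite_subset)
qed

lemma compactin_edge: "e \<in> E \<Longrightarrow> compactin \<T> (edge_point e ` {0..1})"
  by (intro image_compactin[OF _ continuous_map_edge_point]) (simp_all add: compactin_subtopology)

end

text \<open>A compact \<open>K\<close> touches a finite vertex set \<open>N\<close>, so its preimage
  lies in the finitely many vertices and closed edges whose images touch \<open>N\<close>. Being
  closed in this compact set, it is compact.\<close>

lemma proper_continuous_graph_map:
  assumes "vertex_edge_graph V E" "vertex_edge_graph V' E'"
    and F: "continuous_map (graph_topology V E) (graph_topology V' E') F"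
    and vertices: "\<And>h. finite {v \<in> V. h \<in> vertex_support (F (Vertex v))}"
    and edges: "\<And>h. finite {e \<in> E. \<exists>t\<in>{0..1}. h \<in> vertex_support (F (edge_point e t))}"
  shows "proper_continuous_map (graph_topology V E) (graph_topology V' E') F"
proof -
  interpret Y: vertex_edge_graph V E by fact
  interpret Z: vertex_edge_graph V' E' by fact
  have "compactin Y.\<T> {y \<in> topspace Y.\<T>. F y \<in> K}" if K: "compactin Z.\<T> K" for K
  proof -
    define N where "N = \<Union>(vertex_support ` K)"
    define A where "A = (\<Union>h\<in>N. {v \<in> V. h \<in> vertex_support (F (Vertex v))})"
    define B where "B = (\<Union>h\<in>N. {e \<in> E. \<exists>t\<in>{0..1}. h \<in> vertex_support (F (edge_point e t))})"
    have N: "finite N"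
      unfolding N_def using K by (rule Z.finite_vertex_support_compact)
    have fin: "finite A" "finite B"
      unfolding A_def B_def using N vertices edges by auto
    have "compactin Y.\<T> (\<Union>((\<lambda>e. edge_point e ` {0..1}) ` B))"
      using fin by (intro compactin_Union) (auto intro!: Y.compactin_edge simp: B_def)
    moreover have "compactin Y.\<T> (Vertex ` A)"
      using fin by (intro finite_imp_compactin) (auto simp: A_def graph_points_def)
    ultimately have comp: "compactin Y.\<T> (Vertex ` A \<union> \<Union>((\<lambda>e. edge_point e ` {0..1}) ` B))"
      by (rule compactin_Un[rotated])
    have sub: "{y \<in> topspace Y.\<T>. F y \<in> K} \<subseteq> Vertex ` A \<union> \<Union>((\<lambda>e. edge_point e ` {0..1}) ` B)"
    proof
      fix y assume y: "y \<in> {y \<in> topspace Y.\<T>. F y \<in> K}"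
      then obtain h where h: "h \<in> vertex_support (F y)" "h \<in> N"
        using vertex_support_nonempty[of "F y"] by (auto simp: N_def)
      from y have "y \<in> graph_points V E" by simp
      then show "y \<in> Vertex ` A \<union> \<Union>((\<lambda>e. edge_point e ` {0..1}) ` B)"
      proof (cases rule: Y.graph_point_cases)
        case (1 v)
        then show ?thesis using h by (auto simp: A_def)
      next
        case (2 e t)
        then have "e \<in> B" using h unfolding B_def by blast
        then show ?thesis using 2 by blast
      qed
    qed
    have "closedin Z.\<T> K"
      using compactin_imp_closedin[OF Z.Hausdorff_space_graph K] .
    then have "closedin Y.\<T> {y \<in> topspace Y.\<T>. F y \<in> K}"
      using F by (rule closedin_continuous_map_preimage[rotated])
    then show ?thesis
      by (rule closed_compactin[OF comp sub])
  qed
  with F show ?thesis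
    by (auto simp: proper_continuous_map_def)
qed

section \<open>Words and Cayley graphs\<close>

context group
begin

lemma foldr_mult_closed:
  "set ws \<subseteq> carrier G \<Longrightarrow> foldr (\<lambda>s t. s \<otimes> t) ws \<one> \<in> carrier G"
  by (induction ws) auto

lemma foldr_mult_append:
  assumes "set ws \<subseteq> carrier G" "set vs \<subseteq> carrier G"
  shows "foldr (\<lambda>s t. s \<otimes> t) (ws @ vs) \<one> =
    foldr (\<lambda>s t. s \<otimes> t) ws \<one> \<otimes> foldr (\<lambda>s t. s \<otimes> t) vs \<one>"
  using assms(1)
proof (induction ws)
  case Nil
  then show ?case using foldr_mult_closed[OF assms(2)] by simp
next
  case (Cons w ws)
  then show ?case
    using foldr_mult_closed[of ws] foldr_mult_closed[OF assms(2)] by (simp add: m_assoc)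
qed

lemma generate_word:
  assumes S: "S \<subseteq> carrier G" and g: "g \<in> generate G S"
  shows "\<exists>ws. set ws \<subseteq> S \<union> m_inv G ` S \<and> g = foldr (\<lambda>s t. s \<otimes> t) ws \<one>"
  using g
proof induction
  case one
  show ?case by (rule exI[of _ "[]"]) simp
next
  case (incl h)
  then show ?case using S by (intro exI[of _ "[h]"]) auto
next
  case (inv h)
  then show ?case using S by (intro exI[of _ "[inv h]"]) auto
next
  case (eng g h)
  then obtain ws vs where wv: "set ws \<subseteq> S \<union> m_inv G ` S" "g = foldr (\<lambda>s t. s \<otimes> t) ws \<one>"
    "set vs \<subseteq> S \<union> m_inv G ` S" "h = foldr (\<lambda>s t. s \<otimes> t) vs \<one>"
    by blast
  have "S \<union> m_inv G ` S \<subseteq> carrier G"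
    using S by auto
  with wv have "set ws \<subseteq> carrier G" "set vs \<subseteq> carrier G"
    by blast+
  from foldr_mult_append[OF this] show ?case
    using wv by (intro exI[of _ "ws @ vs"]) simp
qed

text \<open>Countability allows the null sets of individual group elements to be united and sums
  over the group to be exchanged with integrals.\<close>

lemma countable_generate:
  assumes "S \<subseteq> carrier G" "countable S"
  shows "countable (generate G S)"
proof (rule countable_subset)
  show "generate G S \<subseteq> (\<lambda>ws. foldr (\<lambda>s t. s \<otimes> t) ws \<one>) ` lists (S \<union> m_inv G ` S)"
    using generate_word[OF assms(1)] by (fastforce simp: lists_eq_set)
  show "countable ((\<lambda>ws. foldr (\<lambda>s t. s \<otimes> t) ws \<one>) ` lists (S \<union> m_inv G ` S))"
    using assms(2) by (intro countable_image countable_lists) auto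
qed

text \<open>Symmetry of \<open>W\<close> absorbs the inverse letters produced by
  \<open>generate\<close>, so some word exists and the least length is attained.\<close>

lemma word_length_word:
  assumes W: "finite_generating_set G W" "symmetric_set G W" and g: "g \<in> carrier G"
  obtains ws where "length ws = word_length G W g" "set ws \<subseteq> W" "g = foldr (\<lambda>s t. s \<otimes> t) ws \<one>"
proof -
  have "W \<subseteq> carrier G" "g \<in> generate G W" "W \<union> m_inv G ` W = W"
    using W g by (auto simp: finite_generating_set_def symmetric_set_def)
  then obtain ws where "set ws \<subseteq> W" "g = foldr (\<lambda>s t. s \<otimes> t) ws \<one>"
    using generate_word[of W g] by auto
  then have "\<exists>n ws. length ws = n \<and> set ws \<subseteq> W \<and> g = foldr (\<lambda>s t. s \<otimes> t) ws \<one>"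
    by blast
  from LeastI_ex[OF this] show thesis
    using that unfolding word_length_def by blast
qed

end

section \<open>Translations and paths in the Cayley graph\<close>

lemma vertex_support_cayley_translation:
  "vertex_support (cayley_translation H g p) = (\<lambda>v. g \<otimes>\<^bsub>H\<^esub> v) ` vertex_support p"
  by (induction H g p rule: cayley_translation.induct) auto

lemma cayley_translation_edge_point:
  "cayley_translation H g (edge_point (u, v) t) = edge_point (g \<otimes>\<^bsub>H\<^esub> u, g \<otimes>\<^bsub>H\<^esub> v) t"
  by (auto simp: edge_point_def)

locale cayley_group = group G for G (structure) +
  fixes S :: "'a set"
  assumes generators: "S \<subseteq> carrier G"
begin

sublocale vertex_edge_graph "carrier G" "cayley_edges G S"
  by unfold_locales (use generators in \<open>auto simp: cayley_edges_def\<close>)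

lemma topspace_cayley_graph [simp]:
  "topspace (cayley_graph G S) = graph_points (carrier G) (cayley_edges G S)"
  by (simp add: cayley_graph_def)

lemma cayley_edge_translate:
  assumes "g \<in> carrier G" "(u, v) \<in> cayley_edges G S"
  shows "(g \<otimes> u, g \<otimes> v) \<in> cayley_edges G S"
proof -
  obtain s where s: "u \<in> carrier G" "s \<in> S" "v = u \<otimes> s"
    using assms by (auto simp: cayley_edges_def)
  then have "g \<otimes> v = g \<otimes> u \<otimes> s" "g \<otimes> u \<in> carrier G"
    using assms generators by (auto simp: m_assoc)
  then show ?thesis
    using s(2) by (auto simp: cayley_edges_def)
qed

lemma cayley_translation_in:
  assumes "g \<in> carrier G" "p \<in> topspace (cayley_graph G S)"
  shows "cayley_translation G g p \<in> topspace (cayley_graph G S)"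
proof -
  have "p \<in> graph_points (carrier G) (cayley_edges G S)"
    using assms by simp
  then show ?thesis
  proof (cases rule: graph_point_cases)
    case (1 v)
    then show ?thesis using assms by (simp add: graph_points_def)
  next
    case (2 e t)
    then show ?thesis
      using assms edge_point_in[of "(g \<otimes> fst e, g \<otimes> snd e)" t] cayley_edge_translate[of g "fst e" "snd e"]
        cayley_translation_edge_point[of G g "fst e" "snd e" t] by simp
  qed
qed

lemma vertex_support_subset:
  assumes "p \<in> topspace (cayley_graph G S)"
  shows "vertex_support p \<subseteq> carrier G"
  using assms edges by (auto simp: graph_points_def)

lemma cayley_translation_mult:
  assumes "g \<in> carrier G" "h \<in> carrier G" "p \<in> topspace (cayley_graph G S)"
  shows "cayley_translation G (g \<otimes> h) p = cayley_translation G g (cayley_translation G h p)"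
  using assms vertex_support_subset[OF assms(3)]
  by (cases "(G, h, p)" rule: cayley_translation.cases) (auto simp: m_assoc)

lemma cayley_translation_one:
  assumes "p \<in> topspace (cayley_graph G S)"
  shows "cayley_translation G \<one> p = p"
  using vertex_support_subset[OF assms]
  by (cases "(G, \<one>, p)" rule: cayley_translation.cases) auto

lemma continuous_map_cayley_translation:
  assumes g: "g \<in> carrier G"
  shows "continuous_map (cayley_graph G S) (cayley_graph G S) (cayley_translation G g)"
  unfolding cayley_graph_def
proof (rule continuous_map_from_graph)
  fix p assume "p \<in> graph_points (carrier G) (cayley_edges G S)"
  then show "cayley_translation G g p \<in> topspace \<T>"
    using cayley_translation_in[OF g] by simp
next
  fix e assume "e \<in> cayley_edges G S"
  then have "continuous_map (top_of_set {0..1}) \<T> (edge_point (g \<otimes> fst e, g \<otimes> snd e))"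
    using cayley_edge_translate[OF g, of "fst e" "snd e"] by (intro continuous_map_edge_point) simp
  then show "continuous_map (top_of_set {0..1}) \<T> (\<lambda>t. cayley_translation G g (edge_point e t))"
    using cayley_translation_edge_point[of G g "fst e" "snd e"] by simp
qed

lemma homeomorphic_map_cayley_translation:
  assumes g: "g \<in> carrier G"
  shows "homeomorphic_map (cayley_graph G S) (cayley_graph G S) (cayley_translation G g)"
proof -
  have "homeomorphic_maps (cayley_graph G S) (cayley_graph G S)
    (cayley_translation G g) (cayley_translation G (inv g))"
    unfolding homeomorphic_maps_def
  proof (intro conjI ballI)
    fix p assume p: "p \<in> topspace (cayley_graph G S)"
    show "cayley_translation G (inv g) (cayley_translation G g p) = p"
      using cayley_translation_mult[OF _ g p, of "inv g"] cayley_translation_one[OF p] g by simp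
    show "cayley_translation G g (cayley_translation G (inv g) p) = p"
      using cayley_translation_mult[OF g _ p, of "inv g"] cayley_translation_one[OF p] g by simp
  qed (use g continuous_map_cayley_translation in auto)
  then show ?thesis
    using homeomorphic_map_maps by blast
qed

text \<open>Stated by path components of a subspace, so that reversal and concatenation of paths
  come from an equivalence relation, while \<open>P\<close> records the vertices the path may
  touch.\<close>

definition joined_within :: "'a set \<Rightarrow> 'a \<Rightarrow> 'a \<Rightarrow> bool" where
  "joined_within P u v \<longleftrightarrow>
     path_component_of (subtopology (cayley_graph G S) {p. vertex_support p \<subseteq> P}) (Vertex u) (Vertex v)"

lemma joined_within_mono: "joined_within P u v \<Longrightarrow> P \<subseteq> Q \<Longrightarrow> joined_within Q u v"
  unfolding joined_within_def by (erule path_component_of_mono) auto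

lemma joined_within_sym: "joined_within P u v \<Longrightarrow> joined_within P v u"
  unfolding joined_within_def by (rule path_component_of_sym)

lemma joined_within_trans: "joined_within P u v \<Longrightarrow> joined_within P v w \<Longrightarrow> joined_within P u w"
  unfolding joined_within_def by (rule path_component_of_trans)

lemma joined_within_Un:
  assumes "joined_within P u v" "joined_within Q v w"
  shows "joined_within (P \<union> Q) u w"
proof (rule joined_within_trans)
  show "joined_within (P \<union> Q) u v" "joined_within (P \<union> Q) v w"
    using assms by (auto elim: joined_within_mono)
qed

lemma joined_within_refl: "u \<in> carrier G \<Longrightarrow> joined_within {u} u u"
  unfolding joined_within_def by (simp add: path_component_of_refl graph_points_def)

lemma joined_within_path:
  assumes "joined_within P u v"
  obtains p where "pathin (cayley_graph G S) p" "p 0 = Vertex u" "p 1 = Vertex v"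
    "\<And>t. t \<in> {0..1} \<Longrightarrow> vertex_support (p t) \<subseteq> P"
proof -
  obtain p where p: "pathin (subtopology (cayley_graph G S) {p. vertex_support p \<subseteq> P}) p"
    "p 0 = Vertex u" "p 1 = Vertex v"
    using assms by (auto simp: joined_within_def path_component_of_def)
  from p(1) show thesis
    unfolding pathin_subtopology using p(2,3) that by blast
qed

lemma joined_within_edge:
  assumes "e \<in> cayley_edges G S"
  shows "joined_within {fst e, snd e} (fst e) (snd e)"
proof -
  have "pathin (subtopology (cayley_graph G S) {p. vertex_support p \<subseteq> {fst e, snd e}}) (edge_point e)"
    unfolding pathin_subtopology
    using continuous_map_edge_point[OF assms] vertex_support_edge_point[of e]
    by (auto simp: pathin_def cayley_graph_def)
  then show ?thesis
    unfolding joined_within_def path_component_of_def by force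
qed

lemma joined_within_translate:
  assumes g: "g \<in> carrier G" and P: "joined_within P u v"
  shows "joined_within ((\<lambda>v. g \<otimes> v) ` P) (g \<otimes> u) (g \<otimes> v)"
proof -
  obtain p where p: "pathin (cayley_graph G S) p" "p 0 = Vertex u" "p 1 = Vertex v"
    "\<And>t. t \<in> {0..1} \<Longrightarrow> vertex_support (p t) \<subseteq> P"
    using joined_within_path[OF P] by blast
  have "pathin (cayley_graph G S) (cayley_translation G g \<circ> p)"
    using p(1) continuous_map_cayley_translation[OF g] by (rule pathin_compose)
  then have "pathin (subtopology (cayley_graph G S) {p. vertex_support p \<subseteq> (\<lambda>v. g \<otimes> v) ` P})
    (cayley_translation G g \<circ> p)"
    unfolding pathin_subtopology using p(4) by (simp add: vertex_support_cayley_translation image_mono)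
  then show ?thesis
    unfolding joined_within_def path_component_of_def using p(2,3) by force
qed

lemma joined_within_generate:
  assumes "g \<in> generate G S"
  shows "\<exists>P. finite P \<and> joined_within P \<one> g"
  using assms
proof induction
  case one
  show ?case using joined_within_refl[of \<one>] by (intro exI[of _ "{\<one>}"]) auto
next
  case (incl h)
  then have "(\<one>, h) \<in> cayley_edges G S"
    using generators unfolding cayley_edges_def by force
  from joined_within_edge[OF this] show ?case
    by (intro exI[of _ "{\<one>, h}"]) simp
next
  case (inv h)
  then have h: "(\<one>, h) \<in> cayley_edges G S" "h \<in> carrier G"
    using generators unfolding cayley_edges_def by force+
  have "joined_within {\<one>, h} h \<one>"
    using joined_within_sym joined_within_edge[OF h(1)] by auto
  \<comment> \<open>The reversed edge from \<open>h\<close> to \<open>\<one>\<close>, translated by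
    \<open>inv h\<close>, runs from \<open>\<one>\<close> to \<open>inv h\<close>.\<close>
  from joined_within_translate[OF _ this, of "inv h"] show ?case
    using h(2) by (intro exI[of _ "{inv h, \<one>}"]) auto
next
  case (eng g h)
  then obtain P Q where PQ: "finite P" "joined_within P \<one> g" "finite Q" "joined_within Q \<one> h"
    by blast
  have gh: "g \<in> carrier G" "h \<in> carrier G"
    using generate_incl[OF generators] eng by auto
  have "joined_within ((\<lambda>v. g \<otimes> v) ` Q) g (g \<otimes> h)"
    using joined_within_translate[OF gh(1) PQ(4)] gh by simp
  then have "joined_within (P \<union> (\<lambda>v. g \<otimes> v) ` Q) \<one> (g \<otimes> h)"
    by (rule joined_within_Un[OF PQ(2)])
  then show ?case
    using PQ by (intro exI[of _ "P \<union> (\<lambda>v. g \<otimes> v) ` Q"]) simp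
qed

text \<open>Lengths are measured in \<open>W\<close>, but the graph is built from \<open>S\<close>.
  Each letter of \<open>W\<close> gets a fixed path in the graph, and a word is followed by
  concatenating translates of these paths; the summand \<open>1\<close> is the base vertex, left
  over for the empty word.\<close>

lemma short_paths:
  assumes S: "generate G S = carrier G"
    and W: "finite_generating_set G W" "symmetric_set G W"
  obtains L :: nat where
    "\<And>g. g \<in> carrier G \<Longrightarrow>
      \<exists>P p. finite P \<and> P \<subseteq> carrier G \<and> card P \<le> L * word_length G W g + 1 \<and>
        pathin (cayley_graph G S) p \<and> p 0 = Vertex \<one> \<and> p 1 = Vertex g \<and>
        (\<forall>t\<in>{0..1}. vertex_support (p t) \<subseteq> P)"
proof -
  have WG: "finite W" "W \<subseteq> carrier G"
    using W by (auto simp: finite_generating_set_def)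
  have "\<forall>w\<in>W. \<exists>P. finite P \<and> joined_within P \<one> w"
    using joined_within_generate S WG by blast
  then obtain Q where Q: "\<And>w. w \<in> W \<Longrightarrow> finite (Q w)" "\<And>w. w \<in> W \<Longrightarrow> joined_within (Q w) \<one> w"
    by metis
  \<comment> \<open>A bound for every \<open>card (Q w)\<close> that also makes sense for empty
    \<open>W\<close>.\<close>
  define L where "L = (\<Sum>w\<in>W. card (Q w))"
  have L: "card (Q w) \<le> L" if "w \<in> W" for w
    unfolding L_def using that WG by (intro member_le_sum) auto
  have words: "\<exists>P. finite P \<and> card P \<le> L * length ws + 1 \<and> joined_within P \<one> (foldr (\<lambda>s t. s \<otimes> t) ws \<one>)"
    if "set ws \<subseteq> W" for ws
    using that
  proof (induction ws)
    case Nil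
    show ?case using joined_within_refl[of \<one>] by (intro exI[of _ "{\<one>}"]) auto
  next
    case (Cons w ws)
    then obtain P where P: "finite P" "card P \<le> L * length ws + 1"
      "joined_within P \<one> (foldr (\<lambda>s t. s \<otimes> t) ws \<one>)"
      by auto
    have w: "w \<in> W" "w \<in> carrier G"
      using Cons WG by auto
    \<comment> \<open>First the path to the letter \<open>w\<close>, then the
      \<open>w\<close>-translate of the path for the remaining word.\<close>
    let ?R = "Q w \<union> (\<lambda>v. w \<otimes> v) ` P"
    have "joined_within ((\<lambda>v. w \<otimes> v) ` P) w (foldr (\<lambda>s t. s \<otimes> t) (w # ws) \<one>)"
      using joined_within_translate[OF w(2) P(3)] w by simp
    then have "joined_within ?R \<one> (foldr (\<lambda>s t. s \<otimes> t) (w # ws) \<one>)"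
      by (rule joined_within_Un[OF Q(2)[OF w(1)]])
    moreover have "card ?R \<le> L * length (w # ws) + 1"
      using card_Un_le[of "Q w" "(\<lambda>v. w \<otimes> v) ` P"] card_image_le[OF P(1), of "\<lambda>v. w \<otimes> v"]
        L[OF w(1)] P(2) by (simp add: algebra_simps)
    ultimately show ?case
      using P(1) Q(1)[OF w(1)] by (intro exI[of _ ?R]) simp
  qed
  have "\<exists>P p. finite P \<and> P \<subseteq> carrier G \<and> card P \<le> L * word_length G W g + 1 \<and>
      pathin (cayley_graph G S) p \<and> p 0 = Vertex \<one> \<and> p 1 = Vertex g \<and>
      (\<forall>t\<in>{0..1}. vertex_support (p t) \<subseteq> P)"
    if g: "g \<in> carrier G" for g
  proof -
    obtain ws where ws: "length ws = word_length G W g" "set ws \<subseteq> W" "g = foldr (\<lambda>s t. s \<otimes> t) ws \<one>"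
      using word_length_word[OF W g] .
    then obtain P where P: "finite P" "card P \<le> L * word_length G W g + 1" "joined_within P \<one> g"
      using words[OF ws(2)] by auto
    obtain p where p: "pathin (cayley_graph G S) p" "p 0 = Vertex \<one>" "p 1 = Vertex g"
      "\<And>t. t \<in> {0..1} \<Longrightarrow> vertex_support (p t) \<subseteq> P"
      using joined_within_path[OF P(3)] by blast
    \<comment> \<open>Points of the graph have supports in the carrier, so \<open>P\<close> can be
      cut down to \<open>P \<inter> carrier G\<close>.\<close>
    have "p t \<in> topspace (cayley_graph G S)" if "t \<in> {0..1}" for t
      using p(1) that by (auto simp: pathin_def continuous_map_def)
    then have "\<forall>t\<in>{0..1}. vertex_support (p t) \<subseteq> P \<inter> carrier G"
      using p(4) vertex_support_subset by blast
    moreover have "card (P \<inter> carrier G) \<le> card P"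
      using P(1) by (simp add: card_mono)
    ultimately show ?thesis
      using P p by (intro exI[of _ "P \<inter> carrier G"] exI[of _ p]) auto
  qed
  then show thesis using that by blast
qed

end

section \<open>Almost sure finiteness of crossings\<close>

text \<open>By Tonelli, the expected number of \<open>i\<close> with \<open>T i x \<in> D i\<close>
  is the sum of the measures of the \<open>D i\<close>, hence equals the expected number of
  \<open>i\<close> with \<open>z \<in> D i\<close>. The substitution is made separately for each
  \<open>i\<close>, with its own map \<open>T i\<close>.\<close>

lemma AE_finite_of_measure_preserving:
  fixes D :: "'i \<Rightarrow> 'x set"
  assumes I: "countable I" and D: "\<And>i. i \<in> I \<Longrightarrow> D i \<in> sets M"
    and T: "\<And>i. i \<in> I \<Longrightarrow> T i \<in> M \<rightarrow>\<^sub>M M" "\<And>i. i \<in> I \<Longrightarrow> distr M M (T i) = M"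
    and fin: "(\<integral>\<^sup>+z. emeasure (count_space I) {i \<in> I. z \<in> D i} \<partial>M) < \<infinity>"
  shows "AE x in M. finite {i \<in> I. T i x \<in> D i}"
proof -
  have count: "(\<integral>\<^sup>+i. indicator (D i) (f i) \<partial>count_space I) = emeasure (count_space I) {i \<in> I. f i \<in> D i}"
    for f :: "'i \<Rightarrow> 'x"
  proof -
    have "(\<integral>\<^sup>+i. indicator (D i) (f i) \<partial>count_space I) =
      (\<integral>\<^sup>+i. indicator {i \<in> I. f i \<in> D i} i \<partial>count_space I)"
      by (intro nn_integral_cong) (auto simp: indicator_def)
    then show ?thesis by simp
  qed
  have meas: "(\<lambda>x. indicator (D i) (T i x) :: ennreal) \<in> borel_measurable M" if "i \<in> I" for i
    using measurable_compose[OF T(1)[OF that] borel_measurable_indicator[OF D[OF that]]] .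
  have inv: "(\<integral>\<^sup>+x. indicator (D i) (T i x) \<partial>M) = (\<integral>\<^sup>+z. indicator (D i) z \<partial>M)" if "i \<in> I" for i
    using nn_integral_distr[OF T(1)[OF that], of "indicator (D i)"] T(2)[OF that] D[OF that] by simp
  \<comment> \<open>Exchange sum and integral, substitute in each term, and exchange back.\<close>
  have "(\<integral>\<^sup>+x. (\<integral>\<^sup>+i. indicator (D i) (T i x) \<partial>count_space I) \<partial>M) =
    (\<integral>\<^sup>+i. (\<integral>\<^sup>+x. indicator (D i) (T i x) \<partial>M) \<partial>count_space I)"
    using I meas by (rule nn_integral_count_space_nn_integral)
  also have "\<dots> = (\<integral>\<^sup>+i. (\<integral>\<^sup>+z. indicator (D i) z \<partial>M) \<partial>count_space I)"
    using inv by (rule nn_integral_cong) simp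
  also have "\<dots> = (\<integral>\<^sup>+z. (\<integral>\<^sup>+i. indicator (D i) z \<partial>count_space I) \<partial>M)"
    using I D by (intro nn_integral_count_space_nn_integral[symmetric]) auto
  also have "\<dots> < \<infinity>"
    using fin by (simp add: count)
  finally have "(\<integral>\<^sup>+x. (\<integral>\<^sup>+i. indicator (D i) (T i x) \<partial>count_space I) \<partial>M) \<noteq> \<infinity>"
    by simp
  \<comment> \<open>Measurability of the count is what turns its finite integral into almost sure
    finiteness.\<close>
  moreover have "(\<lambda>x. \<integral>\<^sup>+i. indicator (D i) (T i x) \<partial>count_space I) \<in> borel_measurable M"
  proof (rule sigma_finite_measure.borel_measurable_nn_integral[where f = "\<lambda>x i. indicator (D i) (T i x)"])
    show "sigma_finite_measure (count_space I)"
      using I by (rule sigma_finite_measure_count_space_countable)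
    have "(\<lambda>(i, x). indicator (D i) (T i x) :: ennreal) \<in> borel_measurable (count_space I \<Otimes>\<^sub>M M)"
      using I meas by (intro measurable_pair_measure_countable1) auto
    from measurable_pair_swap[OF this]
    show "(\<lambda>(x, i). indicator (D i) (T i x) :: ennreal) \<in> borel_measurable (M \<Otimes>\<^sub>M count_space I)"
      by (simp add: split_beta)
  qed
  ultimately have "AE x in M. (\<integral>\<^sup>+i. indicator (D i) (T i x) \<partial>count_space I) \<noteq> \<infinity>"
    by (intro nn_integral_PInf_AE) auto
  then show ?thesis
  proof (rule AE_mp, intro AE_I2 impI)
    fix x assume "(\<integral>\<^sup>+i. indicator (D i) (T i x) \<partial>count_space I) \<noteq> \<infinity>"
    then have "emeasure (count_space I) {i \<in> I. T i x \<in> D i} \<noteq> \<infinity>"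
      unfolding count .
    then show "finite {i \<in> I. T i x \<in> D i}"
      using emeasure_count_space_infinite[of "{i \<in> I. T i x \<in> D i}" I] by blast
  qed
qed

text \<open>For countably many values an arbitrary relation \<open>Q\<close> is allowed: the set is
  a countable union over the pairs of values satisfying \<open>Q\<close>.\<close>

lemma sets_Collect_countable_valued:
  assumes A: "countable A" and u: "u \<in> M \<rightarrow>\<^sub>M count_space A" and v: "v \<in> M \<rightarrow>\<^sub>M count_space A"
  shows "{z \<in> space M. Q (u z) (v z)} \<in> sets M"
proof -
  have "{z \<in> space M. Q (u z) (v z)} =
    (\<Union>a\<in>A. \<Union>b\<in>{b \<in> A. Q a b}. (u -` {a} \<inter> space M) \<inter> (v -` {b} \<inter> space M))"
    using measurable_space[OF u] measurable_space[OF v] by auto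
  also have "\<dots> \<in> sets M"
  proof (rule sets.countable_UN'[OF A], rule image_subsetI)
    fix a assume "a \<in> A"
    show "(\<Union>b\<in>{b \<in> A. Q a b}. (u -` {a} \<inter> space M) \<inter> (v -` {b} \<inter> space M)) \<in> sets M"
    proof (rule sets.countable_UN')
      show "countable {b \<in> A. Q a b}"
        by (rule countable_subset[OF _ A]) auto
    qed (use \<open>a \<in> A\<close> measurable_sets[OF u] measurable_sets[OF v] in auto)
  qed
  finally show ?thesis .
qed

section \<open>Identities for the dual cocycle\<close>

locale action_cocycle =
  \<Gamma>: group \<Gamma> + G: group G + group_action \<Gamma> X \<phi>
  for \<Gamma> :: "('g, 'z) monoid_scheme" and G :: "('h, 'w) monoid_scheme"
    and X :: "'x set" and \<phi> :: "'g \<Rightarrow> 'x \<Rightarrow> 'x" and \<alpha> :: "'g \<Rightarrow> 'x \<Rightarrow> 'h" +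
  assumes cocycle: "cocycle \<Gamma> G X \<phi> \<alpha>"
begin

lemma cocycle_closed: "g \<in> carrier \<Gamma> \<Longrightarrow> x \<in> X \<Longrightarrow> \<alpha> g x \<in> carrier G"
  using cocycle by (auto simp: cocycle_def)

lemma cocycle_mult:
  "g \<in> carrier \<Gamma> \<Longrightarrow> h \<in> carrier \<Gamma> \<Longrightarrow> x \<in> X \<Longrightarrow>
    \<alpha> (g \<otimes>\<^bsub>\<Gamma>\<^esub> h) x = \<alpha> g (\<phi> h x) \<otimes>\<^bsub>G\<^esub> \<alpha> h x"
  using cocycle by (auto simp: cocycle_def)

lemma action_closed: "g \<in> carrier \<Gamma> \<Longrightarrow> x \<in> X \<Longrightarrow> \<phi> g x \<in> X"
  using element_image by blast

lemma action_one: "x \<in> X \<Longrightarrow> \<phi> \<one>\<^bsub>\<Gamma>\<^esub> x = x"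
  using id_eq_one by (metis restrict_apply')

lemma cocycle_one:
  assumes x: "x \<in> X"
  shows "\<alpha> \<one>\<^bsub>\<Gamma>\<^esub> x = \<one>\<^bsub>G\<^esub>"
  using cocycle_mult[OF \<Gamma>.one_closed \<Gamma>.one_closed x] cocycle_closed[OF \<Gamma>.one_closed x]
  by (simp add: action_one[OF x])

text \<open>The cocycle identity for the product of \<open>g\<close> and its inverse, whose cocycle
  value is the identity.\<close>

lemma dual_cocycle_eq:
  assumes g: "g \<in> carrier \<Gamma>" and x: "x \<in> X"
  shows "dual_cocycle \<Gamma> G \<alpha> g x = \<alpha> g (\<phi> (inv\<^bsub>\<Gamma>\<^esub> g) x)"
proof -
  have "\<alpha> g (\<phi> (inv\<^bsub>\<Gamma>\<^esub> g) x) \<otimes>\<^bsub>G\<^esub> \<alpha> (inv\<^bsub>\<Gamma>\<^esub> g) x = \<one>\<^bsub>G\<^esub>"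
    using cocycle_mult[OF g _ x, of "inv\<^bsub>\<Gamma>\<^esub> g"] g cocycle_one[OF x] by simp
  then show ?thesis
    unfolding dual_cocycle_def using g x
    by (intro G.inv_equality) (auto intro!: cocycle_closed action_closed)
qed

lemma dual_cocycle_closed:
  "g \<in> carrier \<Gamma> \<Longrightarrow> x \<in> X \<Longrightarrow> dual_cocycle \<Gamma> G \<alpha> g x \<in> carrier G"
  by (simp add: dual_cocycle_def cocycle_closed)

text \<open>Assertion (1) on vertices. With \<open>y = g\<inverse> x\<close>, applying
  \<open>(k g)\<inverse>\<close> to \<open>k x\<close> also gives \<open>y\<close>, so the cocycle
  identity for \<open>k g\<close> at \<open>y\<close> splits off
  \<open>\<alpha> k x\<close>.\<close>

lemma dual_cocycle_equivariant:
  assumes k: "k \<in> carrier \<Gamma>" and g: "g \<in> carrier \<Gamma>" and x: "x \<in> X"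
  shows "dual_cocycle \<Gamma> G \<alpha> (k \<otimes>\<^bsub>\<Gamma>\<^esub> g) (\<phi> k x) = \<alpha> k x \<otimes>\<^bsub>G\<^esub> dual_cocycle \<Gamma> G \<alpha> g x"
proof -
  let ?y = "\<phi> (inv\<^bsub>\<Gamma>\<^esub> g) x"
  have y: "?y \<in> X" using g x by (simp add: action_closed)
  have "\<phi> (inv\<^bsub>\<Gamma>\<^esub> (k \<otimes>\<^bsub>\<Gamma>\<^esub> g)) (\<phi> k x) = \<phi> (inv\<^bsub>\<Gamma>\<^esub> (k \<otimes>\<^bsub>\<Gamma>\<^esub> g) \<otimes>\<^bsub>\<Gamma>\<^esub> k) x"
    using k g x by (simp add: composition_rule)
  also have "inv\<^bsub>\<Gamma>\<^esub> (k \<otimes>\<^bsub>\<Gamma>\<^esub> g) \<otimes>\<^bsub>\<Gamma>\<^esub> k = inv\<^bsub>\<Gamma>\<^esub> g"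
    using k g by (simp add: \<Gamma>.inv_mult_group \<Gamma>.m_assoc)
  finally have "dual_cocycle \<Gamma> G \<alpha> (k \<otimes>\<^bsub>\<Gamma>\<^esub> g) (\<phi> k x) = \<alpha> (k \<otimes>\<^bsub>\<Gamma>\<^esub> g) ?y"
    using dual_cocycle_eq[of "k \<otimes>\<^bsub>\<Gamma>\<^esub> g" "\<phi> k x"] k g x by (simp add: action_closed)
  also have "\<dots> = \<alpha> k (\<phi> g ?y) \<otimes>\<^bsub>G\<^esub> \<alpha> g ?y"
    using k g y by (rule cocycle_mult)
  also have "\<phi> g ?y = x"
    using composition_rule[OF x g, of "inv\<^bsub>\<Gamma>\<^esub> g"] g action_one[OF x] by simp
  finally show ?thesis
    using dual_cocycle_eq[OF g x] by simp
qed

text \<open>In the variable \<open>z\<close> the displacement along an edge of type \<open>s\<close>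
  becomes \<open>\<alpha> s z\<close>, in which \<open>g\<close> no longer occurs; this permits
  counting over \<open>g\<close> for fixed \<open>z\<close>.\<close>

lemma dual_cocycle_edge:
  assumes g: "g \<in> carrier \<Gamma>" and s: "s \<in> carrier \<Gamma>" and x: "x \<in> X"
  defines "z \<equiv> \<phi> (inv\<^bsub>\<Gamma>\<^esub> (g \<otimes>\<^bsub>\<Gamma>\<^esub> s)) x"
  shows "z \<in> X" "dual_cocycle \<Gamma> G \<alpha> g x = \<alpha> g (\<phi> s z)"
    "dual_cocycle \<Gamma> G \<alpha> (g \<otimes>\<^bsub>\<Gamma>\<^esub> s) x = \<alpha> g (\<phi> s z) \<otimes>\<^bsub>G\<^esub> \<alpha> s z"
proof -
  show z: "z \<in> X"
    unfolding z_def using g s x by (simp add: action_closed)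
  have "\<phi> s z = \<phi> (s \<otimes>\<^bsub>\<Gamma>\<^esub> inv\<^bsub>\<Gamma>\<^esub> (g \<otimes>\<^bsub>\<Gamma>\<^esub> s)) x"
    unfolding z_def using g s x by (simp add: composition_rule)
  also have "s \<otimes>\<^bsub>\<Gamma>\<^esub> inv\<^bsub>\<Gamma>\<^esub> (g \<otimes>\<^bsub>\<Gamma>\<^esub> s) = inv\<^bsub>\<Gamma>\<^esub> g"
    using g s by (simp add: \<Gamma>.inv_mult_group \<Gamma>.m_assoc[symmetric])
  finally show "dual_cocycle \<Gamma> G \<alpha> g x = \<alpha> g (\<phi> s z)"
    using dual_cocycle_eq[OF g x] by simp
  have "dual_cocycle \<Gamma> G \<alpha> (g \<otimes>\<^bsub>\<Gamma>\<^esub> s) x = \<alpha> (g \<otimes>\<^bsub>\<Gamma>\<^esub> s) z"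
    unfolding z_def using g s x by (simp add: dual_cocycle_eq)
  then show "dual_cocycle \<Gamma> G \<alpha> (g \<otimes>\<^bsub>\<Gamma>\<^esub> s) x = \<alpha> g (\<phi> s z) \<otimes>\<^bsub>G\<^esub> \<alpha> s z"
    using cocycle_mult[OF g s z] by simp
qed

end

section \<open>Finite fibres and finite crossings almost surely\<close>

lemma action_cocycle_of_L1_embedding:
  assumes "group \<Gamma>" "group G" "pmp_action \<Gamma> M \<phi>" "L1_embedding \<Gamma> G W M \<phi> \<alpha>"
  shows "action_cocycle \<Gamma> G (space M) \<phi> \<alpha>"
  using assms
  by (auto simp: action_cocycle_def action_cocycle_axioms_def pmp_action_def L1_embedding_def)

text \<open>Inversion in \<open>\<Gamma>\<close> carries the fibre of \<alpha> over the inverse of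
  \<open>h\<close> onto the fibre of the dual cocycle over \<open>h\<close>; countability of
  \<open>G\<close> gives one null set for all \<open>h\<close>.\<close>

lemma AE_finite_fibres:
  assumes \<Gamma>: "group \<Gamma>" and G: "group G" and "countable (carrier G)"
    and "pmp_action \<Gamma> M \<phi>" and emb: "L1_embedding \<Gamma> G W M \<phi> \<alpha>"
  shows "AE x in M. \<forall>h\<in>carrier G. finite {g \<in> carrier \<Gamma>. dual_cocycle \<Gamma> G \<alpha> g x = h}"
proof -
  interpret action_cocycle \<Gamma> G "space M" \<phi> \<alpha>
    using assms by (intro action_cocycle_of_L1_embedding)
  have "\<forall>h\<in>carrier G. AE x in M. finite {g \<in> carrier \<Gamma>. \<alpha> g x = h}"
    using emb unfolding L1_embedding_def by fastforce
  then have "AE x in M. \<forall>h\<in>carrier G. finite {g \<in> carrier \<Gamma>. \<alpha> g x = h}"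
    using \<open>countable (carrier G)\<close> by (simp add: AE_ball_countable)
  then show ?thesis
  proof (rule AE_mp, intro AE_I2 impI ballI)
    fix x h assume x: "x \<in> space M" and h: "h \<in> carrier G"
      and fin: "\<forall>h\<in>carrier G. finite {g \<in> carrier \<Gamma>. \<alpha> g x = h}"
    have "{g \<in> carrier \<Gamma>. dual_cocycle \<Gamma> G \<alpha> g x = h}
      \<subseteq> m_inv \<Gamma> ` {g \<in> carrier \<Gamma>. \<alpha> g x = inv\<^bsub>G\<^esub> h}"
    proof
      fix g assume "g \<in> {g \<in> carrier \<Gamma>. dual_cocycle \<Gamma> G \<alpha> g x = h}"
      then have g: "g \<in> carrier \<Gamma>" "inv\<^bsub>G\<^esub> (\<alpha> (inv\<^bsub>\<Gamma>\<^esub> g) x) = h"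
        by (auto simp: dual_cocycle_def)
      then have "\<alpha> (inv\<^bsub>\<Gamma>\<^esub> g) x = inv\<^bsub>G\<^esub> h"
        using cocycle_closed[of "inv\<^bsub>\<Gamma>\<^esub> g" x] x by auto
      then show "g \<in> m_inv \<Gamma> ` {g \<in> carrier \<Gamma>. \<alpha> g x = inv\<^bsub>G\<^esub> h}"
        using g(1) by (intro image_eqI[of _ _ "inv\<^bsub>\<Gamma>\<^esub> g"]) auto
    qed
    then show "finite {g \<in> carrier \<Gamma>. dual_cocycle \<Gamma> G \<alpha> g x = h}"
      using fin h by (meson G.inv_closed finite_imageI finite_subset)
  qed
qed

text \<open>For fixed \<open>z\<close>, each of the \<open>card (P (\<alpha> s z))\<close> vertices
  of the path accounts for at most \<open>C\<close> elements \<open>g\<close>. The resulting bound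
  is integrable, so \<open>AE_finite_of_measure_preserving\<close> applies.\<close>

lemma AE_finite_crossings:
  fixes L :: nat
  assumes \<Gamma>: "group \<Gamma>" and G: "group G"
    and c\<Gamma>: "countable (carrier \<Gamma>)" and cG: "countable (carrier G)"
    and pmp: "pmp_action \<Gamma> M \<phi>" and emb: "L1_embedding \<Gamma> G W M \<phi> \<alpha>"
    and s: "s \<in> carrier \<Gamma>" and h: "h \<in> carrier G"
    and P: "\<And>w. w \<in> carrier G \<Longrightarrow> finite (P w)" "\<And>w. w \<in> carrier G \<Longrightarrow> P w \<subseteq> carrier G"
      "\<And>w. w \<in> carrier G \<Longrightarrow> card (P w) \<le> L * word_length G W w + 1"
  shows "AE x in M. finite {g \<in> carrier \<Gamma>.
    h \<in> (\<lambda>v. dual_cocycle \<Gamma> G \<alpha> g x \<otimes>\<^bsub>G\<^esub> v) `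
      P (inv\<^bsub>G\<^esub> (dual_cocycle \<Gamma> G \<alpha> g x) \<otimes>\<^bsub>G\<^esub> dual_cocycle \<Gamma> G \<alpha> (g \<otimes>\<^bsub>\<Gamma>\<^esub> s) x)}"
proof -
  interpret action_cocycle \<Gamma> G "space M" \<phi> \<alpha>
    using assms by (intro action_cocycle_of_L1_embedding)
  interpret prob_space M
    using pmp by (simp add: pmp_action_def)
  have \<phi>: "\<phi> g \<in> M \<rightarrow>\<^sub>M M" "distr M M (\<phi> g) = M" if "g \<in> carrier \<Gamma>" for g
    using pmp that by (auto simp: pmp_action_def)
  have \<alpha>: "\<alpha> g \<in> M \<rightarrow>\<^sub>M count_space (carrier G)" if "g \<in> carrier \<Gamma>" for g
  proof -
    have "(\<lambda>(g, x). \<alpha> g x) \<in> count_space (carrier \<Gamma>) \<Otimes>\<^sub>M M \<rightarrow>\<^sub>M count_space (carrier G)"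
      using emb by (simp add: L1_embedding_def)
    from measurable_compose[OF measurable_Pair1'[of g "count_space (carrier \<Gamma>)" M] this] that
    show ?thesis by simp
  qed
  have int: "integrable M (\<lambda>z. real (word_length G W (\<alpha> s z)))"
    using emb s by (simp add: L1_embedding_def)
  obtain C :: real where C: "C > 0" "\<forall>h\<in>carrier G. AE x in M.
      finite {g \<in> carrier \<Gamma>. \<alpha> g x = h} \<and> real (card {g \<in> carrier \<Gamma>. \<alpha> g x = h}) \<le> C"
    using emb unfolding L1_embedding_def by blast
  then have all: "AE x in M. \<forall>h\<in>carrier G.
      finite {g \<in> carrier \<Gamma>. \<alpha> g x = h} \<and> real (card {g \<in> carrier \<Gamma>. \<alpha> g x = h}) \<le> C"
    using cG by (simp add: AE_ball_countable)
  \<comment> \<open>The fibre bound is needed at \<open>s z\<close>; since \<open>\<phi> s\<close>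
    preserves the measure, the exceptional set pulls back to a null set.\<close>
  have fibres: "AE z in M. \<forall>h\<in>carrier G. finite {g \<in> carrier \<Gamma>. \<alpha> g (\<phi> s z) = h} \<and>
      real (card {g \<in> carrier \<Gamma>. \<alpha> g (\<phi> s z) = h}) \<le> C"
    by (rule AE_distrD[OF \<phi>(1)[OF s]]) (simp only: \<phi>(2)[OF s] all)
  \<comment> \<open>The event, in the variable \<open>z\<close>, that the image of the edge from
    \<open>g\<close> to \<open>g s\<close> may visit \<open>h\<close>.\<close>
  define D where "D g = {z \<in> space M. h \<in> (\<lambda>v. \<alpha> g (\<phi> s z) \<otimes>\<^bsub>G\<^esub> v) ` P (\<alpha> s z)}" for g
  have D: "D g \<in> sets M" if "g \<in> carrier \<Gamma>" for g
    unfolding D_def using sets_Collect_countable_valued[OF cG measurable_compose[OF \<phi>(1)[OF s] \<alpha>[OF that]] \<alpha>[OF s],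
      of "\<lambda>a b. h \<in> (\<lambda>v. a \<otimes>\<^bsub>G\<^esub> v) ` P b"] by simp
  have bound: "AE z in M. emeasure (count_space (carrier \<Gamma>)) {g \<in> carrier \<Gamma>. z \<in> D g} \<le>
      ennreal (C * (L * real (word_length G W (\<alpha> s z)) + 1))"
    using fibres
  proof (rule AE_mp, intro AE_I2 impI)
    fix z assume z: "z \<in> space M"
      and fib: "\<forall>h\<in>carrier G. finite {g \<in> carrier \<Gamma>. \<alpha> g (\<phi> s z) = h} \<and>
        real (card {g \<in> carrier \<Gamma>. \<alpha> g (\<phi> s z) = h}) \<le> C"
    have w: "\<alpha> s z \<in> carrier G"
      using s z by (rule cocycle_closed)
    \<comment> \<open>If the visit to \<open>h\<close> occurs at the path vertex \<open>q\<close>,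
      then \<open>\<alpha> g (s z)\<close> is determined by \<open>h\<close> and \<open>q\<close>,
      so \<open>g\<close> lies in a single fibre.\<close>
    let ?A = "\<lambda>q. {g \<in> carrier \<Gamma>. \<alpha> g (\<phi> s z) = h \<otimes>\<^bsub>G\<^esub> inv\<^bsub>G\<^esub> q}"
    have hq: "h \<otimes>\<^bsub>G\<^esub> inv\<^bsub>G\<^esub> q \<in> carrier G" if "q \<in> P (\<alpha> s z)" for q
      using P(2)[OF w] that h by auto
    have fin: "finite (\<Union>(?A ` P (\<alpha> s z)))"
      using fib hq P(1)[OF w] by blast
    have sub: "{g \<in> carrier \<Gamma>. z \<in> D g} \<subseteq> \<Union>(?A ` P (\<alpha> s z))"
    proof
      fix g assume "g \<in> {g \<in> carrier \<Gamma>. z \<in> D g}"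
      then obtain q where g: "g \<in> carrier \<Gamma>" and q: "q \<in> P (\<alpha> s z)" "h = \<alpha> g (\<phi> s z) \<otimes>\<^bsub>G\<^esub> q"
        by (auto simp: D_def)
      have "\<alpha> g (\<phi> s z) \<in> carrier G" "q \<in> carrier G"
        using g s z q P(2)[OF w] by (auto intro: cocycle_closed action_closed)
      then have "\<alpha> g (\<phi> s z) = h \<otimes>\<^bsub>G\<^esub> inv\<^bsub>G\<^esub> q"
        using q(2) by (simp add: G.m_assoc)
      then show "g \<in> \<Union>(?A ` P (\<alpha> s z))"
        using g q(1) by blast
    qed
    have "real (card {g \<in> carrier \<Gamma>. z \<in> D g}) \<le> real (\<Sum>q\<in>P (\<alpha> s z). card (?A q))"
      using card_mono[OF fin sub] card_UN_le[OF P(1)[OF w], of ?A] by linarith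
    also have "\<dots> \<le> (\<Sum>q\<in>P (\<alpha> s z). C)"
      unfolding of_nat_sum using fib hq by (intro sum_mono) blast
    also have "\<dots> = C * card (P (\<alpha> s z))"
      by simp
    also have "\<dots> \<le> C * (L * real (word_length G W (\<alpha> s z)) + 1)"
    proof (rule mult_left_mono)
      have "real (card (P (\<alpha> s z))) \<le> real (L * word_length G W (\<alpha> s z) + 1)"
        using P(3)[OF w] by (simp only: of_nat_le_iff)
      then show "real (card (P (\<alpha> s z))) \<le> L * real (word_length G W (\<alpha> s z)) + 1"
        by simp
    qed (use C(1) in simp)
    finally have "real (card {g \<in> carrier \<Gamma>. z \<in> D g}) \<le> C * (L * real (word_length G W (\<alpha> s z)) + 1)" .
    moreover have "emeasure (count_space (carrier \<Gamma>)) {g \<in> carrier \<Gamma>. z \<in> D g} =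
      ennreal (real (card {g \<in> carrier \<Gamma>. z \<in> D g}))"
      using finite_subset[OF sub fin] by (subst emeasure_count_space_finite) (auto simp: ennreal_of_nat_eq_real_of_nat)
    ultimately show "emeasure (count_space (carrier \<Gamma>)) {g \<in> carrier \<Gamma>. z \<in> D g} \<le>
      ennreal (C * (L * real (word_length G W (\<alpha> s z)) + 1))"
      by (simp add: ennreal_leI)
  qed
  have "(\<integral>\<^sup>+z. emeasure (count_space (carrier \<Gamma>)) {g \<in> carrier \<Gamma>. z \<in> D g} \<partial>M) \<le>
    (\<integral>\<^sup>+z. ennreal (C * (L * real (word_length G W (\<alpha> s z)) + 1)) \<partial>M)"
    using bound by (rule nn_integral_mono_AE)
  also have "\<dots> = ennreal (\<integral>z. C * (L * real (word_length G W (\<alpha> s z)) + 1) \<partial>M)"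
    using int C(1) by (intro nn_integral_eq_integral) auto
  also have "\<dots> < \<infinity>"
    by simp
  \<comment> \<open>The measure-preserving map attached to \<open>g\<close> is the action of
    \<open>(g s)\<inverse>\<close>, which sends \<open>x\<close> to \<open>z\<close>.\<close>
  finally have "AE x in M. finite {g \<in> carrier \<Gamma>. \<phi> (inv\<^bsub>\<Gamma>\<^esub> (g \<otimes>\<^bsub>\<Gamma>\<^esub> s)) x \<in> D g}"
    using D \<phi> s by (intro AE_finite_of_measure_preserving c\<Gamma>) auto
  then show ?thesis
  proof (rule AE_mp, intro AE_I2 impI)
    fix x assume x: "x \<in> space M"
      and fin: "finite {g \<in> carrier \<Gamma>. \<phi> (inv\<^bsub>\<Gamma>\<^esub> (g \<otimes>\<^bsub>\<Gamma>\<^esub> s)) x \<in> D g}"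
    show "finite {g \<in> carrier \<Gamma>.
      h \<in> (\<lambda>v. dual_cocycle \<Gamma> G \<alpha> g x \<otimes>\<^bsub>G\<^esub> v) `
        P (inv\<^bsub>G\<^esub> (dual_cocycle \<Gamma> G \<alpha> g x) \<otimes>\<^bsub>G\<^esub> dual_cocycle \<Gamma> G \<alpha> (g \<otimes>\<^bsub>\<Gamma>\<^esub> s) x)}"
    proof (rule finite_subset[OF _ fin], safe)
      fix g v assume g: "g \<in> carrier \<Gamma>"
        and v: "v \<in> P (inv\<^bsub>G\<^esub> (dual_cocycle \<Gamma> G \<alpha> g x) \<otimes>\<^bsub>G\<^esub> dual_cocycle \<Gamma> G \<alpha> (g \<otimes>\<^bsub>\<Gamma>\<^esub> s) x)"
        and hv: "h = dual_cocycle \<Gamma> G \<alpha> g x \<otimes>\<^bsub>G\<^esub> v"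
      define z where "z = \<phi> (inv\<^bsub>\<Gamma>\<^esub> (g \<otimes>\<^bsub>\<Gamma>\<^esub> s)) x"
      note e = dual_cocycle_edge[OF g s x, folded z_def]
      have "\<alpha> g (\<phi> s z) \<in> carrier G" "\<alpha> s z \<in> carrier G"
        using g s e(1) by (auto intro: cocycle_closed action_closed)
      then have "inv\<^bsub>G\<^esub> (\<alpha> g (\<phi> s z)) \<otimes>\<^bsub>G\<^esub> (\<alpha> g (\<phi> s z) \<otimes>\<^bsub>G\<^esub> \<alpha> s z) = \<alpha> s z"
        by (simp add: G.m_assoc[symmetric])
      then have "v \<in> P (\<alpha> s z)" "h = \<alpha> g (\<phi> s z) \<otimes>\<^bsub>G\<^esub> v"
        using v hv e(2,3) by auto
      then show "\<phi> (inv\<^bsub>\<Gamma>\<^esub> (g \<otimes>\<^bsub>\<Gamma>\<^esub> s)) x \<in> D g"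
        using e(1) unfolding z_def[symmetric] D_def by blast
    qed
  qed
qed

section \<open>Extending maps of vertices over the edges\<close>

text \<open>Here \<open>p w\<close> is intended as a path from the identity to \<open>w\<close>. The
  image of an edge uses only the displacement of its ends, which is invariant under left
  translation.\<close>

fun path_extension ::
  "('h, 'w) monoid_scheme \<Rightarrow> ('h \<Rightarrow> real \<Rightarrow> 'h graph_point) \<Rightarrow> ('g \<Rightarrow> 'h) \<Rightarrow>
   'g graph_point \<Rightarrow> 'h graph_point" where
  "path_extension G p f (Vertex v) = Vertex (f v)"
| "path_extension G p f (Inner (u, v) t) =
     cayley_translation G (f u) (p (inv\<^bsub>G\<^esub> (f u) \<otimes>\<^bsub>G\<^esub> f v) t)"

locale cayley_vertex_map =
  \<Gamma>: cayley_group \<Gamma> S\<^sub>\<Gamma> + G: cayley_group G S\<^sub>G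
  for \<Gamma> :: "('g, 'z) monoid_scheme" and S\<^sub>\<Gamma> :: "'g set"
    and G :: "('h, 'w) monoid_scheme" and S\<^sub>G :: "'h set"
    and p :: "'h \<Rightarrow> real \<Rightarrow> 'h graph_point" +
  assumes path: "\<And>w. w \<in> carrier G \<Longrightarrow> pathin (cayley_graph G S\<^sub>G) (p w)"
    and path_start: "\<And>w. w \<in> carrier G \<Longrightarrow> p w 0 = Vertex \<one>\<^bsub>G\<^esub>"
    and path_end: "\<And>w. w \<in> carrier G \<Longrightarrow> p w 1 = Vertex w"
begin

lemma path_in:
  "w \<in> carrier G \<Longrightarrow> t \<in> {0..1} \<Longrightarrow> p w t \<in> topspace (cayley_graph G S\<^sub>G)"
  using path[of w] by (auto simp: pathin_def continuous_map_def)

text \<open>The formula for inner points remains valid at both ends because \<open>p w\<close>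
  starts at the identity and ends at \<open>w\<close>.\<close>

lemma path_extension_edge_point:
  assumes "f u \<in> carrier G" "f v \<in> carrier G"
  shows "path_extension G p f (edge_point (u, v) t) =
    cayley_translation G (f u) (p (inv\<^bsub>G\<^esub> (f u) \<otimes>\<^bsub>G\<^esub> f v) t)"
proof -
  have "inv\<^bsub>G\<^esub> (f u) \<otimes>\<^bsub>G\<^esub> f v \<in> carrier G"
    using assms by simp
  then show ?thesis
    using assms path_start path_end
    by (auto simp: edge_point_def G.m_assoc[symmetric])
qed

lemma continuous_map_path_extension:
  assumes f: "\<And>g. g \<in> carrier \<Gamma> \<Longrightarrow> f g \<in> carrier G"
  shows "continuous_map (cayley_graph \<Gamma> S\<^sub>\<Gamma>) (cayley_graph G S\<^sub>G) (path_extension G p f)"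
proof -
  have edge: "continuous_map (top_of_set {0..1}) (cayley_graph G S\<^sub>G)
      (\<lambda>t. path_extension G p f (edge_point e t))" if e_in: "e \<in> cayley_edges \<Gamma> S\<^sub>\<Gamma>" for e
  proof -
    obtain u v where e: "e = (u, v)" "u \<in> carrier \<Gamma>" "v \<in> carrier \<Gamma>"
      using subsetD[OF \<Gamma>.edges e_in] by (cases e) auto
    have "continuous_map (top_of_set {0..1}) (cayley_graph G S\<^sub>G)
        (cayley_translation G (f u) \<circ> p (inv\<^bsub>G\<^esub> (f u) \<otimes>\<^bsub>G\<^esub> f v))"
      using path[of "inv\<^bsub>G\<^esub> (f u) \<otimes>\<^bsub>G\<^esub> f v"] f e G.continuous_map_cayley_translation[of "f u"]
      unfolding pathin_def by (intro continuous_map_compose) auto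
    then show ?thesis
      using path_extension_edge_point[of f u v, OF f f] e by (simp add: o_def)
  qed
  show ?thesis
    unfolding cayley_graph_def[of \<Gamma>]
  proof (rule \<Gamma>.continuous_map_from_graph[OF _ edge])
    fix y assume "y \<in> graph_points (carrier \<Gamma>) (cayley_edges \<Gamma> S\<^sub>\<Gamma>)"
    then show "path_extension G p f y \<in> topspace (cayley_graph G S\<^sub>G)"
    proof (cases rule: \<Gamma>.graph_point_cases)
      case (1 v)
      then show ?thesis using f by (simp add: graph_points_def)
    next
      case (2 e t)
      then show ?thesis
        using continuous_map_image_subset_topspace[OF edge[OF 2(1)]] by auto
    qed
  qed
qed

text \<open>Left multiplication by \<open>a\<close> cancels in
  \<open>(a f u)\<inverse> (a f v)\<close>, so the edge and its translate use the same path
  \<open>p w\<close>.\<close>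

lemma path_extension_equivariant:
  assumes f: "\<And>g. g \<in> carrier \<Gamma> \<Longrightarrow> f g \<in> carrier G" and a: "a \<in> carrier G"
    and f': "\<And>g. g \<in> carrier \<Gamma> \<Longrightarrow> f' (k \<otimes>\<^bsub>\<Gamma>\<^esub> g) = a \<otimes>\<^bsub>G\<^esub> f g"
    and y: "y \<in> topspace (cayley_graph \<Gamma> S\<^sub>\<Gamma>)"
  shows "path_extension G p f' (cayley_translation \<Gamma> k y) =
    cayley_translation G a (path_extension G p f y)"
proof -
  have "y \<in> graph_points (carrier \<Gamma>) (cayley_edges \<Gamma> S\<^sub>\<Gamma>)"
    using y by simp
  then show ?thesis
  proof (cases rule: \<Gamma>.graph_point_cases)
    case (1 v)
    then show ?thesis using f' by simp
  next
    case (2 e t)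
    obtain u v where e: "e = (u, v)" "u \<in> carrier \<Gamma>" "v \<in> carrier \<Gamma>"
      using subsetD[OF \<Gamma>.edges 2(1)] by (cases e) auto
    let ?w = "inv\<^bsub>G\<^esub> (f u) \<otimes>\<^bsub>G\<^esub> f v"
    have fuv: "f u \<in> carrier G" "f v \<in> carrier G"
      using e f by auto
    have w: "inv\<^bsub>G\<^esub> (a \<otimes>\<^bsub>G\<^esub> f u) \<otimes>\<^bsub>G\<^esub> (a \<otimes>\<^bsub>G\<^esub> f v) = ?w"
    proof -
      have "inv\<^bsub>G\<^esub> (a \<otimes>\<^bsub>G\<^esub> f u) \<otimes>\<^bsub>G\<^esub> (a \<otimes>\<^bsub>G\<^esub> f v) =
        inv\<^bsub>G\<^esub> (f u) \<otimes>\<^bsub>G\<^esub> (inv\<^bsub>G\<^esub> a \<otimes>\<^bsub>G\<^esub> (a \<otimes>\<^bsub>G\<^esub> f v))"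
        using a fuv by (simp add: G.inv_mult_group G.m_assoc)
      also have "inv\<^bsub>G\<^esub> a \<otimes>\<^bsub>G\<^esub> (a \<otimes>\<^bsub>G\<^esub> f v) = f v"
        using a fuv by (simp add: G.m_assoc[symmetric])
      finally show ?thesis .
    qed
    have "path_extension G p f' (cayley_translation \<Gamma> k y) =
      cayley_translation G (a \<otimes>\<^bsub>G\<^esub> f u) (p ?w t)"
      using 2(3) e a fuv w f'
      by (simp add: cayley_translation_edge_point path_extension_edge_point)
    also have "\<dots> = cayley_translation G a (cayley_translation G (f u) (p ?w t))"
      using a fuv path_in[OF _ 2(2), of ?w] by (intro G.cayley_translation_mult) auto
    finally show ?thesis
      using 2(3) e fuv by (simp add: path_extension_edge_point)
  qed
qed

text \<open>Edges are indexed by a start \<open>g\<close> and one of finitely many \<open>s\<close>,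
  so finite fibres and finite crossings give the two conditions of
  \<open>proper_continuous_graph_map\<close>.\<close>

lemma proper_path_extension:
  assumes f: "\<And>g. g \<in> carrier \<Gamma> \<Longrightarrow> f g \<in> carrier G" and S: "finite S\<^sub>\<Gamma>"
    and P: "\<And>w. w \<in> carrier G \<Longrightarrow> P w \<subseteq> carrier G"
      "\<And>w t. w \<in> carrier G \<Longrightarrow> t \<in> {0..1} \<Longrightarrow> vertex_support (p w t) \<subseteq> P w"
    and fibres: "\<And>h. h \<in> carrier G \<Longrightarrow> finite {g \<in> carrier \<Gamma>. f g = h}"
    and crossings: "\<And>s h. s \<in> S\<^sub>\<Gamma> \<Longrightarrow> h \<in> carrier G \<Longrightarrow>
      finite {g \<in> carrier \<Gamma>. h \<in> (\<lambda>v. f g \<otimes>\<^bsub>G\<^esub> v) ` P (inv\<^bsub>G\<^esub> (f g) \<otimes>\<^bsub>G\<^esub> f (g \<otimes>\<^bsub>\<Gamma>\<^esub> s))}"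
  shows "proper_continuous_map (cayley_graph \<Gamma> S\<^sub>\<Gamma>) (cayley_graph G S\<^sub>G) (path_extension G p f)"
  unfolding cayley_graph_def
proof (rule proper_continuous_graph_map)
  show "vertex_edge_graph (carrier \<Gamma>) (cayley_edges \<Gamma> S\<^sub>\<Gamma>)"
    "vertex_edge_graph (carrier G) (cayley_edges G S\<^sub>G)"
    by (fact \<Gamma>.vertex_edge_graph_axioms G.vertex_edge_graph_axioms)+
  show "continuous_map (graph_topology (carrier \<Gamma>) (cayley_edges \<Gamma> S\<^sub>\<Gamma>))
      (graph_topology (carrier G) (cayley_edges G S\<^sub>G)) (path_extension G p f)"
    using continuous_map_path_extension[OF f] by (simp add: cayley_graph_def)
  fix h
  show "finite {v \<in> carrier \<Gamma>. h \<in> vertex_support (path_extension G p f (Vertex v))}"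
  proof (cases "h \<in> carrier G")
    case True
    then show ?thesis using fibres[OF True] by (simp add: eq_commute)
  next
    case False
    then have "{v \<in> carrier \<Gamma>. h \<in> vertex_support (path_extension G p f (Vertex v))} = {}"
      using f by auto
    then show ?thesis by (simp only: finite.emptyI)
  qed
  let ?A = "\<lambda>s. {g \<in> carrier \<Gamma>. h \<in> (\<lambda>v. f g \<otimes>\<^bsub>G\<^esub> v) ` P (inv\<^bsub>G\<^esub> (f g) \<otimes>\<^bsub>G\<^esub> f (g \<otimes>\<^bsub>\<Gamma>\<^esub> s))}"
  have A: "finite (?A s)" if s: "s \<in> S\<^sub>\<Gamma>" for s
  proof (cases "h \<in> carrier G")
    case True
    then show ?thesis using crossings[OF s] by simp
  next
    case False
    have "s \<in> carrier \<Gamma>" using s \<Gamma>.generators by auto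
    then have "P (inv\<^bsub>G\<^esub> (f g) \<otimes>\<^bsub>G\<^esub> f (g \<otimes>\<^bsub>\<Gamma>\<^esub> s)) \<subseteq> carrier G" if "g \<in> carrier \<Gamma>" for g
      using f that by (intro P(1)) auto
    \<comment> \<open>All vertices on the image paths lie in the carrier, so an \<open>h\<close>
      outside it is never visited.\<close>
    then have "?A s = {}"
      using False f by blast
    then show ?thesis by (simp only: finite.emptyI)
  qed
  have "{e \<in> cayley_edges \<Gamma> S\<^sub>\<Gamma>. \<exists>t\<in>{0..1}. h \<in> vertex_support (path_extension G p f (edge_point e t))}
    \<subseteq> (\<Union>s\<in>S\<^sub>\<Gamma>. (\<lambda>g. (g, g \<otimes>\<^bsub>\<Gamma>\<^esub> s)) ` ?A s)"
  proof
    fix e assume "e \<in> {e \<in> cayley_edges \<Gamma> S\<^sub>\<Gamma>.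
      \<exists>t\<in>{0..1}. h \<in> vertex_support (path_extension G p f (edge_point e t))}"
    then obtain g s t where e: "e = (g, g \<otimes>\<^bsub>\<Gamma>\<^esub> s)" "g \<in> carrier \<Gamma>" "s \<in> S\<^sub>\<Gamma>"
      and t: "t \<in> {0..1}" "h \<in> vertex_support (path_extension G p f (edge_point e t))"
      by (auto simp: cayley_edges_def)
    let ?w = "inv\<^bsub>G\<^esub> (f g) \<otimes>\<^bsub>G\<^esub> f (g \<otimes>\<^bsub>\<Gamma>\<^esub> s)"
    have gs: "f g \<in> carrier G" "f (g \<otimes>\<^bsub>\<Gamma>\<^esub> s) \<in> carrier G"
      using e \<Gamma>.generators f by auto
    have "h \<in> (\<lambda>v. f g \<otimes>\<^bsub>G\<^esub> v) ` vertex_support (p ?w t)"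
      using t(2) unfolding e(1) path_extension_edge_point[of f, OF gs] vertex_support_cayley_translation .
    moreover have "vertex_support (p ?w t) \<subseteq> P ?w"
      using gs t(1) by (intro P(2)) auto
    ultimately have "g \<in> ?A s"
      using e(2) by blast
    then show "e \<in> (\<Union>s\<in>S\<^sub>\<Gamma>. (\<lambda>g. (g, g \<otimes>\<^bsub>\<Gamma>\<^esub> s)) ` ?A s)"
      using e by blast
  qed
  then show "finite {e \<in> cayley_edges \<Gamma> S\<^sub>\<Gamma>.
      \<exists>t\<in>{0..1}. h \<in> vertex_support (path_extension G p f (edge_point e t))}"
    by (rule finite_subset) (use A S in auto)
qed

end

section \<open>Assembling the extension of the dual cocycle\<close>

theorem theorem3p1:
  fixes \<Gamma> :: "('g, 'z) monoid_scheme" and G :: "('h, 'w) monoid_scheme"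
    and M :: "'x measure" and \<phi> :: "'g \<Rightarrow> 'x \<Rightarrow> 'x" and \<alpha> :: "'g \<Rightarrow> 'x \<Rightarrow> 'h"
    and W\<^sub>G S\<^sub>G :: "'h set" and S\<^sub>\<Gamma> :: "'g set"
  assumes "group \<Gamma>" and "group G"
    and "finite_generating_set G W\<^sub>G" and "symmetric_set G W\<^sub>G"
    and "finite_generating_set \<Gamma> S\<^sub>\<Gamma>" and "finite_generating_set G S\<^sub>G"
    and "pmp_action \<Gamma> M \<phi>"
    and "L1_embedding \<Gamma> G W\<^sub>G M \<phi> \<alpha>"
  shows "\<exists>\<alpha>' :: 'g graph_point compactified \<Rightarrow> 'x \<Rightarrow> 'h graph_point compactified.
    (\<forall>\<xi>\<in>topspace (group_compactification \<Gamma> S\<^sub>\<Gamma>). \<forall>x\<in>space M.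
       \<alpha>' \<xi> x \<in> topspace (group_compactification G S\<^sub>G)) \<and>
    (\<forall>g\<in>carrier \<Gamma>. \<forall>x\<in>space M.
       \<alpha>' (Pt (Vertex g)) x = Pt (Vertex (dual_cocycle \<Gamma> G \<alpha> g x))) \<and>
    (AE x in M. \<forall>g\<in>carrier \<Gamma>. \<forall>\<xi>\<in>topspace (group_compactification \<Gamma> S\<^sub>\<Gamma>).
       \<alpha>' (compactified_action \<Gamma> S\<^sub>\<Gamma> g \<xi>) (\<phi> g x) =
       compactified_action G S\<^sub>G (\<alpha> g x) (\<alpha>' \<xi> x)) \<and>
    (AE x in M. continuous_map (group_compactification \<Gamma> S\<^sub>\<Gamma>) (group_compactification G S\<^sub>G)
       (\<lambda>\<xi>. \<alpha>' \<xi> x))"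
proof -
  interpret action_cocycle \<Gamma> G "space M" \<phi> \<alpha>
    using assms by (intro action_cocycle_of_L1_embedding)
  have S: "finite S\<^sub>\<Gamma>" "S\<^sub>\<Gamma> \<subseteq> carrier \<Gamma>" "generate \<Gamma> S\<^sub>\<Gamma> = carrier \<Gamma>"
    "finite S\<^sub>G" "S\<^sub>G \<subseteq> carrier G" "generate G S\<^sub>G = carrier G"
    using assms by (auto simp: finite_generating_set_def)
  have c\<Gamma>: "countable (carrier \<Gamma>)"
    using \<Gamma>.countable_generate[of S\<^sub>\<Gamma>] S by (simp add: countable_finite)
  have cG: "countable (carrier G)"
    using G.countable_generate[of S\<^sub>G] S by (simp add: countable_finite)
  interpret Z: cayley_group G S\<^sub>G
    by unfold_locales (fact S)
  obtain L :: nat where "\<And>g. g \<in> carrier G \<Longrightarrow> \<exists>P p. finite P \<and> P \<subseteq> carrier G \<and>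
      card P \<le> L * word_length G W\<^sub>G g + 1 \<and>
      pathin (cayley_graph G S\<^sub>G) p \<and> p 0 = Vertex \<one>\<^bsub>G\<^esub> \<and> p 1 = Vertex g \<and>
      (\<forall>t\<in>{0..1}. vertex_support (p t) \<subseteq> P)"
    using Z.short_paths[OF S(6) assms(3,4)] by blast
  then have "\<forall>g\<in>carrier G. \<exists>P p. finite P \<and> P \<subseteq> carrier G \<and>
      card P \<le> L * word_length G W\<^sub>G g + 1 \<and>
      pathin (cayley_graph G S\<^sub>G) p \<and> p 0 = Vertex \<one>\<^bsub>G\<^esub> \<and> p 1 = Vertex g \<and>
      (\<forall>t\<in>{0..1}. vertex_support (p t) \<subseteq> P)"
    by blast
  then obtain P p where Pp: "\<forall>g\<in>carrier G. finite (P g) \<and> P g \<subseteq> carrier G \<and>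
      card (P g) \<le> L * word_length G W\<^sub>G g + 1 \<and>
      pathin (cayley_graph G S\<^sub>G) (p g) \<and> p g 0 = Vertex \<one>\<^bsub>G\<^esub> \<and> p g 1 = Vertex g \<and>
      (\<forall>t\<in>{0..1}. vertex_support (p g t) \<subseteq> P g)"
    unfolding bchoice_iff by blast
  interpret cayley_vertex_map \<Gamma> S\<^sub>\<Gamma> G S\<^sub>G p
    by unfold_locales (use S Pp in auto)
  let ?Y = "cayley_graph \<Gamma> S\<^sub>\<Gamma>" and ?Z = "cayley_graph G S\<^sub>G"
  define f where "f x g = dual_cocycle \<Gamma> G \<alpha> g x" for x g
  define F where "F x = path_extension G p (f x)" for x
  \<comment> \<open>Points of the graph always follow \<open>F x\<close>. If \<open>F x\<close> is
    not proper, ends are sent to the identity vertex, so that the values lie in the compactification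
    for every \<open>x\<close>.\<close>
  define \<alpha>' where "\<alpha>' \<xi> x = (if (\<exists>y. \<xi> = Pt y) \<or> proper_continuous_map ?Y ?Z (F x)
    then compactified_map ?Y ?Z (F x) \<xi> else Pt (Vertex \<one>\<^bsub>G\<^esub>))" for \<xi> x
  have f: "f x g \<in> carrier G" if "g \<in> carrier \<Gamma>" "x \<in> space M" for g x
    unfolding f_def using that by (rule dual_cocycle_closed)
  have "AE x in M. \<forall>s\<in>S\<^sub>\<Gamma>. \<forall>h\<in>carrier G. finite {g \<in> carrier \<Gamma>.
      h \<in> (\<lambda>v. f x g \<otimes>\<^bsub>G\<^esub> v) ` P (inv\<^bsub>G\<^esub> (f x g) \<otimes>\<^bsub>G\<^esub> f x (g \<otimes>\<^bsub>\<Gamma>\<^esub> s))}"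
    unfolding f_def
  proof (intro AE_ball_countable')
    fix s h assume "s \<in> S\<^sub>\<Gamma>" "h \<in> carrier G"
    then show "AE x in M. finite {g \<in> carrier \<Gamma>. h \<in> (\<lambda>v. dual_cocycle \<Gamma> G \<alpha> g x \<otimes>\<^bsub>G\<^esub> v) `
        P (inv\<^bsub>G\<^esub> (dual_cocycle \<Gamma> G \<alpha> g x) \<otimes>\<^bsub>G\<^esub> dual_cocycle \<Gamma> G \<alpha> (g \<otimes>\<^bsub>\<Gamma>\<^esub> s) x)}"
      using S(2) Pp
      by (intro AE_finite_crossings[OF assms(1,2) c\<Gamma> cG assms(7,8), where L = L]) auto
  qed (use S(1) cG in \<open>auto intro: countable_finite\<close>)
  moreover have "AE x in M. \<forall>h\<in>carrier G. finite {g \<in> carrier \<Gamma>. f x g = h}"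
    unfolding f_def using assms(1,2) cG assms(7,8) by (rule AE_finite_fibres)
  ultimately have proper: "AE x in M. proper_continuous_map ?Y ?Z (F x)"
    using AE_space
  proof eventually_elim
    case (elim x)
    then show ?case
      unfolding F_def using f S(1) Pp by (intro proper_path_extension[where P = P]) auto
  qed
  \<comment> \<open>Equivariance compares \<open>F x\<close> with \<open>F (\<phi> g x)\<close>, so
    both must be proper. Measure preservation handles each \<open>g\<close>, and countability of
    \<open>\<Gamma>\<close> handles all of them at once.\<close>
  have proper_translate: "AE x in M. \<forall>g\<in>carrier \<Gamma>. proper_continuous_map ?Y ?Z (F (\<phi> g x))"
  proof (rule AE_ball_countable'[OF _ c\<Gamma>])
    fix g assume "g \<in> carrier \<Gamma>"
    then have \<phi>: "\<phi> g \<in> M \<rightarrow>\<^sub>M M" "distr M M (\<phi> g) = M"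
      using assms(7) by (auto simp: pmp_action_def)
    show "AE x in M. proper_continuous_map ?Y ?Z (F (\<phi> g x))"
      by (rule AE_distrD[OF \<phi>(1)]) (simp only: \<phi>(2) proper)
  qed
  have "\<alpha>' \<xi> x \<in> topspace (group_compactification G S\<^sub>G)"
    if \<xi>: "\<xi> \<in> topspace (group_compactification \<Gamma> S\<^sub>\<Gamma>)" and x: "x \<in> space M" for \<xi> x
  proof -
    have "continuous_map ?Y ?Z (F x)"
      unfolding F_def using f x by (intro continuous_map_path_extension) auto
    then have "F x ` topspace ?Y \<subseteq> topspace ?Z"
      by (rule continuous_map_image_subset_topspace)
    moreover have "Vertex \<one>\<^bsub>G\<^esub> \<in> topspace ?Z"
      by (simp add: graph_points_def)
    ultimately show ?thesis
      using \<xi> end_map_in_ends[of ?Y ?Z "F x"] unfolding topspace_end_compactification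
      by (auto simp: \<alpha>'_def)
  qed
  moreover have "\<alpha>' (Pt (Vertex g)) x = Pt (Vertex (dual_cocycle \<Gamma> G \<alpha> g x))" for g x
    by (simp add: \<alpha>'_def F_def f_def)
  moreover have "AE x in M. \<forall>g\<in>carrier \<Gamma>. \<forall>\<xi>\<in>topspace (group_compactification \<Gamma> S\<^sub>\<Gamma>).
       \<alpha>' (compactified_action \<Gamma> S\<^sub>\<Gamma> g \<xi>) (\<phi> g x) =
       compactified_action G S\<^sub>G (\<alpha> g x) (\<alpha>' \<xi> x)"
    using proper proper_translate AE_space
  proof eventually_elim
    case (elim x)
    show ?case
    proof (intro ballI)
      fix g \<xi> assume g: "g \<in> carrier \<Gamma>" and \<xi>: "\<xi> \<in> topspace (group_compactification \<Gamma> S\<^sub>\<Gamma>)"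
      have a: "\<alpha> g x \<in> carrier G"
        using g elim(3) by (rule cocycle_closed)
      \<comment> \<open>Equivariance on vertices spreads over the edges, since the image paths
        depend on displacements only.\<close>
      have F: "F (\<phi> g x) (cayley_translation \<Gamma> g y) = cayley_translation G (\<alpha> g x) (F x y)"
        if "y \<in> topspace ?Y" for y
        unfolding F_def using f[OF _ elim(3)] a _ that
      proof (rule path_extension_equivariant)
        show "f (\<phi> g x) (g \<otimes>\<^bsub>\<Gamma>\<^esub> h) = \<alpha> g x \<otimes>\<^bsub>G\<^esub> f x h" if "h \<in> carrier \<Gamma>" for h
          unfolding f_def using g that elim(3) by (rule dual_cocycle_equivariant)
      qed
      consider y where "y \<in> topspace ?Y" "\<xi> = Pt y" | \<eta> where "\<eta> \<in> ends ?Y" "\<xi> = End \<eta>"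
        using \<xi> unfolding topspace_end_compactification by blast
      then show "\<alpha>' (compactified_action \<Gamma> S\<^sub>\<Gamma> g \<xi>) (\<phi> g x) =
          compactified_action G S\<^sub>G (\<alpha> g x) (\<alpha>' \<xi> x)"
      proof cases
        case 1
        then show ?thesis
          using F by (simp add: \<alpha>'_def compactified_action_def)
      next
        case 2
        have "compactified_map ?Y ?Z (F (\<phi> g x)) (end_extension ?Y (cayley_translation \<Gamma> g) (End \<eta>)) =
            end_extension ?Z (cayley_translation G (\<alpha> g x)) (compactified_map ?Y ?Z (F x) (End \<eta>))"
          using elim(1,2) g a F 2(1)
          by (intro end_map_equivariant \<Gamma>.homeomorphic_map_cayley_translation
              Z.homeomorphic_map_cayley_translation) auto
        then show ?thesis
          using elim(1,2) g 2(2) by (simp add: \<alpha>'_def compactified_action_def)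
      qed
    qed
  qed
  moreover have "AE x in M. continuous_map (group_compactification \<Gamma> S\<^sub>\<Gamma>) (group_compactification G S\<^sub>G)
       (\<lambda>\<xi>. \<alpha>' \<xi> x)"
    using proper
  proof eventually_elim
    case (elim x)
    have "continuous_map (group_compactification \<Gamma> S\<^sub>\<Gamma>) (group_compactification G S\<^sub>G)
      (compactified_map ?Y ?Z (F x))"
      using elim
    \<comment> \<open>The two topological requirements are the Hausdorff property and local
      connectedness of the Cayley graph of \<open>G\<close>.\<close>
    proof (rule continuous_compactified_map)
      show "closedin ?Z K" if "compactin ?Z K" for K
        using that compactin_imp_closedin[OF Z.Hausdorff_space_graph] by (simp add: cayley_graph_def)
      show "openin ?Z C" if "openin ?Z U" "C \<in> connected_components_of (subtopology ?Z U)" for U C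
        using that Z.openin_graph_component by (simp add: cayley_graph_def)
    qed
    then show ?case
      using elim by (simp add: \<alpha>'_def)
  qed
  ultimately show ?thesis
    by blast
qed

end
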